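(* Let $\alpha>0$, let $W(s,\omega)$, $s>0$, be a Wiener process, let $\tilde\psi_n^{\alpha}$, $n\in\mathbb{N}_0$, be the transformed Hermite functions on $(0,1)$, and let $w(s)=\frac{1}{s(1-s)}$. Then the random variables $$\tilde B_n(\omega)=\int_0^1\tilde\psi_n^{\alpha}(s)\sqrt{w(s)}\,dW(s,\omega),\qquad n\in\mathbb{N}_0,$$ are independent.
   Context: $\mathbb{N}_0=\{0,1,2,\dots\}$. The Hermite polynomials are $H_n(t)=(-1)^n e^{t^2}\frac{d^n}{dt^n}e^{-t^2}$. For $\alpha>0$ the generalized Hermite functions are $\psi_n^{\alpha}(t)=\frac{\sqrt{\alpha}}{\sqrt{2^n n!\sqrt{\pi}}}H_n(\alpha t)e^{-\alpha^2t^2/2}$, $t\in\mathbb{R}$. With $\phi(x)=\ln\frac{x}{1-x}$, $x\in(0,1)$, the transformed Hermite functions are $\tilde\psi_n^{\alpha}(x)=\psi_n^{\alpha}(\phi(x))$, $x\in(0,1)$. The weight is $w(x)=\phi'(x)=\frac{1}{x(1-x)}$, and $L^2_w(0,1)$ is the space of measurable $g$ on $(0,1)$ with $\int_0^1|g(x)|^2w(x)\,dx<\infty$. For $f\in L^2(0,1)$ the stochastic integral $\int_0^1 f(s)\,dW(s,\omega)$ is defined in quadratic mean (i.e. as an $L^2(\Omega)$ limit; the Wiener integral), with $E\left|\int_0^1 f\,dW\right|^2=c^2\int_0^1|f(s)|^2ds$, where $c>0$ is the constant associated with the normal law of the increments of $W$; hence $\int_0^1 f(s)\sqrt{w(s)}\,dW(s,\omega)$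 is defined for $f\in L^2_w(0,1)$. *)

theory Defs
  imports "HOL-Probability.Probability"
begin

definition hermite :: "nat \<Rightarrow> real \<Rightarrow> real" where
  "hermite n t = (-1) ^ n * exp (t ^ 2) * (deriv ^^ n) (\<lambda>u. exp (- (u ^ 2))) t"

definition hermite_fun :: "real \<Rightarrow> nat \<Rightarrow> real \<Rightarrow> real" where
  "hermite_fun \<alpha> n t =
     sqrt \<alpha> / sqrt (2 ^ n * fact n * sqrt pi) * hermite n (\<alpha> * t) * exp (- (\<alpha> ^ 2 * t ^ 2 / 2))"

definition logit :: "real \<Rightarrow> real" where
  "logit x = ln (x / (1 - x))"

definition transformed_hermite :: "real \<Rightarrow> nat \<Rightarrow> real \<Rightarrow> real" where
  "transformed_hermite \<alpha> n x = hermite_fun \<alpha> n (logit x)"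

definition logit_weight :: "real \<Rightarrow> real" where
  "logit_weight x = 1 / (x * (1 - x))"

text \<open>The times are the nonnegative reals; only \<open>W t\<close> with \<open>t \<ge> 0\<close> is constrained.
  The increment over \<open>[s, t]\<close> has standard deviation \<open>c * sqrt (t - s)\<close>.\<close>

locale wiener_process = prob_space M for M :: "'a measure" +
  fixes W :: "real \<Rightarrow> 'a \<Rightarrow> real" and c :: real
  assumes scale_pos: "c > 0"
    and measurable_at: "\<And>t. 0 \<le> t \<Longrightarrow> random_variable borel (W t)"
    and start_zero: "AE \<omega> in M. W 0 \<omega> = 0"
    and continuous_paths: "AE \<omega> in M. continuous_on {0..} (\<lambda>t. W t \<omega>)"
    and normal_increments: "\<And>s t. 0 \<le> s \<Longrightarrow> s < t \<Longrightarrow>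
      distributed M lborel (\<lambda>\<omega>. W t \<omega> - W s \<omega>) (normal_density 0 (c * sqrt (t - s)))"
    and independent_increments: "\<And>(n::nat) t. 0 \<le> t 0 \<Longrightarrow> (\<And>i. i < n \<Longrightarrow> t i \<le> t (Suc i)) \<Longrightarrow>
      indep_vars (\<lambda>_. borel) (\<lambda>i \<omega>. W (t (Suc i)) \<omega> - W (t i) \<omega>) {..<n}"

definition square_integrable :: "'b measure \<Rightarrow> ('b \<Rightarrow> real) \<Rightarrow> bool" where
  "square_integrable N f \<longleftrightarrow> f \<in> borel_measurable N \<and> integrable N (\<lambda>x. (f x)\<^sup>2)"

text \<open>Membership in the space is part of the definition, since the Bochner integral of a
  non-integrable function is 0.\<close>

definition tendsto_L2 :: "'b measure \<Rightarrow> (nat \<Rightarrow> 'b \<Rightarrow> real) \<Rightarrow> ('b \<Rightarrow> real) \<Rightarrow> bool" where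
  "tendsto_L2 N F f \<longleftrightarrow>
     (\<forall>k. square_integrable N (F k)) \<and> square_integrable N f \<and>
     (\<lambda>k. LINT x|N. (F k x - f x)\<^sup>2) \<longlonglongrightarrow> 0"

definition partition_of :: "real \<Rightarrow> real \<Rightarrow> nat \<Rightarrow> (nat \<Rightarrow> real) \<Rightarrow> bool" where
  "partition_of a b n t \<longleftrightarrow> t 0 = a \<and> t n = b \<and> (\<forall>i<n. t i < t (Suc i))"

definition step_fun :: "nat \<Rightarrow> (nat \<Rightarrow> real) \<Rightarrow> (nat \<Rightarrow> real) \<Rightarrow> real \<Rightarrow> real" where
  "step_fun n t y s = (\<Sum>i<n. y i * indicator {t i<..t (Suc i)} s)"

definition step_integral ::
  "(real \<Rightarrow> 'a \<Rightarrow> real) \<Rightarrow> nat \<Rightarrow> (nat \<Rightarrow> real) \<Rightarrow> (nat \<Rightarrow> real) \<Rightarrow> 'a \<Rightarrow> real" where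
  "step_integral W n t y \<omega> = (\<Sum>i<n. y i * (W (t (Suc i)) \<omega> - W (t i) \<omega>))"

text \<open>\<open>X\<close> is a version of the stochastic integral of \<open>f\<close> over \<open>(a, b)\<close>: the limit in quadratic
  mean of the integrals of step functions converging to \<open>f\<close> in \<open>L\<^sup>2(a, b)\<close>.\<close>

definition has_wiener_integral ::
  "'a measure \<Rightarrow> (real \<Rightarrow> 'a \<Rightarrow> real) \<Rightarrow> real \<Rightarrow> real \<Rightarrow> (real \<Rightarrow> real) \<Rightarrow> ('a \<Rightarrow> real) \<Rightarrow> bool" where
  "has_wiener_integral M W a b f X \<longleftrightarrow>
     (\<exists>n t y. (\<forall>k. partition_of a b (n k) (t k)) \<and>
        tendsto_L2 (lebesgue_on {a<..<b}) (\<lambda>k. step_fun (n k) (t k) (y k)) f \<and>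
        tendsto_L2 M (\<lambda>k. step_integral W (n k) (t k) (y k)) X)"

text \<open>The integral is determined only up to almost sure equality; the choice operator picks
  a version. If there is none, the value is unspecified.\<close>

definition wiener_integral ::
  "'a measure \<Rightarrow> (real \<Rightarrow> 'a \<Rightarrow> real) \<Rightarrow> real \<Rightarrow> real \<Rightarrow> (real \<Rightarrow> real) \<Rightarrow> 'a \<Rightarrow> real" where
  "wiener_integral M W a b f = (SOME X. has_wiener_integral M W a b f X)"

end

theory Submission
  imports Defs "HOL-Computational_Algebra.Polynomial"
begin

text \<open>
The integrals \<open>B\<^sub>n\<close> are jointly Gaussian and uncorrelated, hence independent. Both properties are
expressed at once by the joint characteristic function.

For a step function the stochastic integral is a sum of independent normal increments, and its
characteristic function is \<open>exp (- u\<^sup>2 c\<^sup>2 \<parallel>f\<parallel>\<^sup>2 / 2)\<close> with the norm of \<open>L\<^sup>2(a, b)\<close>. Limits in quadratic mean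
preserve this formula (\<open>has_wiener_integral_char\<close>). Since the integral is linear
(\<open>has_wiener_integral_linear\<close>), the characteristic function of \<open>\<Sum>\<^sub>j u\<^sub>j B\<^sub>j\<close> depends only on
\<open>\<parallel>\<Sum>\<^sub>j u\<^sub>j f\<^sub>j\<parallel>\<^sup>2\<close>. For pairwise orthogonal integrands Pythagoras turns this into \<open>\<Sum>\<^sub>j u\<^sub>j\<^sup>2 \<parallel>f\<^sub>j\<parallel>\<^sup>2\<close>, and the
joint characteristic function is the product of the individual ones. That such a factorisation
implies independence (\<open>indep_vars_if_char_factors\<close>) is deduced from Levy's uniqueness theorem on the
line, by a change of measure for one variable at a time.

The integrands are \<open>f\<^sub>n = \<psi>\<^sub>n(logit s) sqrt (w s)\<close>, and \<open>w\<close> is the derivative of \<open>logit\<close>; so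
\<open>\<integral> f\<^sub>n f\<^sub>m ds\<close> is the inner product of two Hermite functions on the line, which vanishes for \<open>n \<noteq> m\<close>
because \<open>H\<^sub>n exp (- t\<^sup>2)\<close> is, up to sign, the \<open>n\<close>-th derivative of a Gaussian and annihilates polynomials
of lower degree (\<open>weighted_hermite_orthogonal\<close>). The integrals exist because \<open>f\<^sub>n\<close> extends
continuously by 0 to the end points (\<open>continuous_weighted_hermite\<close>): step functions then converge to
it uniformly, their integrals are Cauchy in quadratic mean by the isometry, and \<open>L\<^sup>2\<close> is complete.
\<close>

section \<open>Independence from factorising characteristic functions\<close>

text \<open>The hypothesis compares characteristic functions: shifted by a constant, \<open>Z\<close> becomes a positive
density, and tilting the probability by this density leaves the characteristic function of \<open>X\<close>
unchanged. By Levy's uniqueness theorem the law of \<open>X\<close> is then unchanged too, so the density can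
be tested against indicators of \<open>X\<close> instead of exponentials.\<close>

lemma (in prob_space) real_factor_indicator_if_char_factors:
  fixes X Z :: "'a \<Rightarrow> real"
  assumes X[measurable]: "random_variable borel X" and Z[measurable]: "random_variable borel Z"
    and bound: "\<And>\<omega>. \<bar>Z \<omega>\<bar> \<le> B"
    and factor: "\<And>u. expectation (\<lambda>\<omega>. iexp (u * X \<omega>) * of_real (Z \<omega>)) =
      expectation (\<lambda>\<omega>. iexp (u * X \<omega>)) * of_real (expectation Z)"
    and A[measurable]: "A \<in> sets borel"
  shows "expectation (\<lambda>\<omega>. indicator A (X \<omega>) * Z \<omega>) =
    expectation (\<lambda>\<omega>. indicator A (X \<omega>)) * expectation Z"
proof -
  have intZ: "integrable M Z"
    by (rule integrable_const_bound[of _ B]) (auto simp: bound)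
  \<comment> \<open>The extra 1 keeps the total mass positive even when \<open>Z\<close> is constantly \<open>- B\<close>.\<close>
  define D where "D = (\<lambda>\<omega>. Z \<omega> + B + 1)"
  define e where "e = expectation D"
  have D[measurable]: "D \<in> borel_measurable M" unfolding D_def by measurable
  have D1: "D \<omega> \<ge> 1" for \<omega> using bound[of \<omega>] unfolding D_def by linarith
  have intD: "integrable M D" unfolding D_def using intZ by simp
  have eZ: "e = expectation Z + B + 1"
    unfolding e_def D_def using intZ by (simp add: prob_space)
  have "expectation (\<lambda>_. 1) \<le> e"
    unfolding e_def by (rule integral_mono) (use D1 intD in auto)
  then have epos: "e > 0" by (simp add: prob_space)
  define N where "N = density M (\<lambda>\<omega>. ennreal (D \<omega> / e))"
  have nonneg: "0 \<le> D \<omega> / e" for \<omega> using D1[of \<omega>] epos by simp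
  have XN[measurable]: "X \<in> borel_measurable N" unfolding N_def by simp
  have "emeasure N (space N) = (\<integral>\<^sup>+\<omega>. ennreal (D \<omega> / e) \<partial>M)"
    unfolding N_def by (simp add: emeasure_density cong: nn_integral_cong_simp)
  also have "\<dots> = ennreal (expectation (\<lambda>\<omega>. D \<omega> / e))"
    by (rule nn_integral_eq_integral) (use intD nonneg in auto)
  also have "\<dots> = 1" using epos unfolding e_def by simp
  finally interpret N: prob_space N by (intro prob_spaceI)
  have int_iexp: "integrable M (\<lambda>\<omega>. iexp (u * X \<omega>))" for u
    by (rule integrable_const_bound[of _ 1]) auto
  have int_iexpZ: "integrable M (\<lambda>\<omega>. iexp (u * X \<omega>) * of_real (Z \<omega>))" for u
    by (rule integrable_const_bound[of _ B]) (auto simp: norm_mult bound)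
  have charN: "char (distr N borel X) u = char (distr M borel X) u" for u
  proof -
    have "char (distr N borel X) u = (CLINT \<omega>|N. iexp (u * X \<omega>))"
      by (simp add: char_def integral_distr)
    also have "\<dots> = expectation (\<lambda>\<omega>. (D \<omega> / e) *\<^sub>R iexp (u * X \<omega>))"
      unfolding N_def by (rule integral_density) (use nonneg in auto)
    also have "\<dots> = expectation (\<lambda>\<omega>. iexp (u * X \<omega>) * of_real (Z \<omega>) / of_real e
        + of_real ((B + 1) / e) * iexp (u * X \<omega>))"
      by (rule Bochner_Integration.integral_cong)
        (use epos in \<open>auto simp: D_def scaleR_conv_of_real field_simps\<close>)
    also have "\<dots> = expectation (\<lambda>\<omega>. iexp (u * X \<omega>)) * of_real (expectation Z) / of_real e
        + of_real ((B + 1) / e) * expectation (\<lambda>\<omega>. iexp (u * X \<omega>))"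
      using int_iexp[of u] int_iexpZ[of u] factor[of u] by simp
    also have "\<dots> = expectation (\<lambda>\<omega>. iexp (u * X \<omega>)) * of_real ((expectation Z + B + 1) / e)"
      using epos by (simp add: field_simps)
    also have "\<dots> = char (distr M borel X) u"
      using epos by (simp add: char_def integral_distr flip: eZ)
    finally show ?thesis .
  qed
  have "distr N borel X = distr M borel X"
    by (rule Levy_uniqueness) (use charN in auto)
  then have "measure (distr N borel X) A = measure (distr M borel X) A" by simp
  then have "measure N (X -` A \<inter> space N) = measure M (X -` A \<inter> space M)"
    by (simp add: measure_distr)
  moreover have "measure N (X -` A \<inter> space N) = (LINT \<omega>|N. indicator A (X \<omega>))"
    by (subst Bochner_Integration.integral_cong[OF refl, of _ _ "indicator (X -` A \<inter> space N)"])
      (auto simp: indicator_def)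
  moreover have "(LINT \<omega>|N. indicator A (X \<omega>) :: real) = expectation (\<lambda>\<omega>. (D \<omega> / e) *\<^sub>R indicator A (X \<omega>))"
    unfolding N_def by (rule integral_density) (use nonneg in auto)
  moreover have "measure M (X -` A \<inter> space M) = expectation (\<lambda>\<omega>. indicator A (X \<omega>))"
    by (subst Bochner_Integration.integral_cong[OF refl, of _ _ "indicator (X -` A \<inter> space M)"])
      (auto simp: indicator_def)
  moreover have "expectation (\<lambda>\<omega>. (D \<omega> / e) *\<^sub>R indicator A (X \<omega>)) =
      expectation (\<lambda>\<omega>. indicator A (X \<omega>) * Z \<omega> / e + (B + 1) / e * indicator A (X \<omega>))"
    by (rule Bochner_Integration.integral_cong)
      (use epos in \<open>auto simp: D_def field_simps split: split_indicator\<close>)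
  moreover have intA: "integrable M (\<lambda>\<omega>. indicator A (X \<omega>) :: real)"
    by (rule integrable_const_bound[of _ 1]) (auto simp: indicator_def)
  moreover have intAZ: "integrable M (\<lambda>\<omega>. indicator A (X \<omega>) * Z \<omega>)"
    by (rule integrable_const_bound[of _ B]) (auto simp: indicator_def bound intro: order_trans[OF _ bound])
  ultimately have "expectation (\<lambda>\<omega>. indicator A (X \<omega>)) =
     expectation (\<lambda>\<omega>. indicator A (X \<omega>) * Z \<omega>) / e + (B + 1) / e * expectation (\<lambda>\<omega>. indicator A (X \<omega>))"
    by simp
  then have "e * expectation (\<lambda>\<omega>. indicator A (X \<omega>)) =
     expectation (\<lambda>\<omega>. indicator A (X \<omega>) * Z \<omega>) + (B + 1) * expectation (\<lambda>\<omega>. indicator A (X \<omega>))"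
    using epos by (simp add: field_simps)
  then show ?thesis unfolding eZ by (simp add: algebra_simps)
qed

text \<open>Since the hypothesis is available for \<open>u\<close> and \<open>- u\<close>, it passes to the complex conjugate of \<open>Z\<close>, hence
to its real and imaginary parts.\<close>

lemma (in prob_space) factor_indicator_if_char_factors:
  fixes X :: "'a \<Rightarrow> real" and Z :: "'a \<Rightarrow> complex"
  assumes X[measurable]: "random_variable borel X" and Z[measurable]: "random_variable borel Z"
    and bound: "\<And>\<omega>. norm (Z \<omega>) \<le> B"
    and factor: "\<And>u. expectation (\<lambda>\<omega>. iexp (u * X \<omega>) * Z \<omega>) =
      expectation (\<lambda>\<omega>. iexp (u * X \<omega>)) * expectation Z"
    and A[measurable]: "A \<in> sets borel"
  shows "expectation (\<lambda>\<omega>. indicator A (X \<omega>) * Z \<omega>) =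
    of_real (expectation (\<lambda>\<omega>. indicator A (X \<omega>))) * expectation Z"
proof -
  have intZ: "integrable M Z"
    by (rule integrable_const_bound[of _ B]) (auto simp: bound)
  have int: "integrable M (\<lambda>\<omega>. iexp (u * X \<omega>) * Z \<omega>)" for u
    by (rule integrable_const_bound[of _ B]) (auto simp: bound norm_mult)
  have [measurable]: "random_variable borel (\<lambda>\<omega>. cnj (Z \<omega>))"
    by (rule measurable_compose[OF Z borel_measurable_continuous_onI]) (intro continuous_intros)
  have cnj_int: "integrable M (\<lambda>\<omega>. iexp (u * X \<omega>) * cnj (Z \<omega>))" for u
    by (rule integrable_const_bound[of _ B]) (auto simp: bound norm_mult)
  have cnj_factor: "expectation (\<lambda>\<omega>. iexp (u * X \<omega>) * cnj (Z \<omega>)) =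
      expectation (\<lambda>\<omega>. iexp (u * X \<omega>)) * cnj (expectation Z)" for u
  proof -
    have "expectation (\<lambda>\<omega>. iexp (u * X \<omega>) * cnj (Z \<omega>)) =
        expectation (\<lambda>\<omega>. cnj (iexp ((- u) * X \<omega>) * Z \<omega>))"
      by (simp add: exp_cnj)
    also have "\<dots> = cnj (expectation (\<lambda>\<omega>. iexp ((- u) * X \<omega>) * Z \<omega>))"
      by (rule Bochner_Integration.integral_cnj)
    also have "\<dots> = cnj (expectation (\<lambda>\<omega>. iexp ((- u) * X \<omega>))) * cnj (expectation Z)"
      by (simp only: factor complex_cnj_mult)
    also have "cnj (expectation (\<lambda>\<omega>. iexp ((- u) * X \<omega>))) = expectation (\<lambda>\<omega>. iexp (u * X \<omega>))"
      by (subst Bochner_Integration.integral_cnj[symmetric]) (simp add: exp_cnj)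
    finally show ?thesis .
  qed
  have Re_fact: "expectation (\<lambda>\<omega>. indicator A (X \<omega>) * Re (Z \<omega>)) =
      expectation (\<lambda>\<omega>. indicator A (X \<omega>)) * expectation (\<lambda>\<omega>. Re (Z \<omega>))"
  proof (rule real_factor_indicator_if_char_factors[of _ _ B])
    fix u
    have "expectation (\<lambda>\<omega>. iexp (u * X \<omega>) * of_real (Re (Z \<omega>))) =
      expectation (\<lambda>\<omega>. (iexp (u * X \<omega>) * Z \<omega> + iexp (u * X \<omega>) * cnj (Z \<omega>)) / 2)"
      by (rule Bochner_Integration.integral_cong) (auto simp: complex_add_cnj simp flip: distrib_left)
    also have "\<dots> = expectation (\<lambda>\<omega>. iexp (u * X \<omega>)) * ((expectation Z + cnj (expectation Z)) / 2)"
      using int[of u] cnj_int[of u] factor[of u] cnj_factor[of u] by (simp add: distrib_left)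
    also have "(expectation Z + cnj (expectation Z)) / 2 = of_real (expectation (\<lambda>\<omega>. Re (Z \<omega>)))"
      using intZ by (simp add: complex_add_cnj)
    finally show "expectation (\<lambda>\<omega>. iexp (u * X \<omega>) * of_real (Re (Z \<omega>))) =
      expectation (\<lambda>\<omega>. iexp (u * X \<omega>)) * of_real (expectation (\<lambda>\<omega>. Re (Z \<omega>)))" .
  qed (use abs_Re_le_cmod bound order_trans in \<open>auto, blast\<close>)
  have Im_split: "e * of_real (Im z) = (e * z - e * cnj z) / (2 * \<i>)" for e z
  proof -
    have "e * z - e * cnj z = e * (of_real (2 * Im z) * \<i>)"
      by (simp only: complex_diff_cnj flip: right_diff_distrib)
    then show ?thesis by (simp add: field_simps)
  qed
  have Im_fact: "expectation (\<lambda>\<omega>. indicator A (X \<omega>) * Im (Z \<omega>)) =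
      expectation (\<lambda>\<omega>. indicator A (X \<omega>)) * expectation (\<lambda>\<omega>. Im (Z \<omega>))"
  proof (rule real_factor_indicator_if_char_factors[of _ _ B])
    fix u
    have "expectation (\<lambda>\<omega>. iexp (u * X \<omega>) * of_real (Im (Z \<omega>))) =
      expectation (\<lambda>\<omega>. (iexp (u * X \<omega>) * Z \<omega> - iexp (u * X \<omega>) * cnj (Z \<omega>)) / (2 * \<i>))"
      by (simp only: Im_split)
    also have "\<dots> = expectation (\<lambda>\<omega>. iexp (u * X \<omega>)) * ((expectation Z - cnj (expectation Z)) / (2 * \<i>))"
      using int[of u] cnj_int[of u] factor[of u] cnj_factor[of u] by (simp add: right_diff_distrib)
    also have "(expectation Z - cnj (expectation Z)) / (2 * \<i>) = of_real (expectation (\<lambda>\<omega>. Im (Z \<omega>)))"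
      using intZ Im_split[of 1 "expectation Z"] by simp
    finally show "expectation (\<lambda>\<omega>. iexp (u * X \<omega>) * of_real (Im (Z \<omega>))) =
      expectation (\<lambda>\<omega>. iexp (u * X \<omega>)) * of_real (expectation (\<lambda>\<omega>. Im (Z \<omega>)))" .
  qed (use abs_Im_le_cmod bound order_trans in \<open>auto, blast\<close>)
  have intAZ: "integrable M (\<lambda>\<omega>. indicator A (X \<omega>) * Z \<omega>)"
    by (rule integrable_const_bound[of _ B])
      (auto simp: indicator_def bound intro: order_trans[OF _ bound] order_trans[OF norm_ge_zero bound])
  have RI: "Re (indicator A x * z) = indicator A x * Re z" "Im (indicator A x * z) = indicator A x * Im z"
    for x :: real and z by (auto simp: indicator_def)
  show ?thesis
  proof (rule complex_eqI)
    show "Re (expectation (\<lambda>\<omega>. indicator A (X \<omega>) * Z \<omega>)) =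
      Re (of_real (expectation (\<lambda>\<omega>. indicator A (X \<omega>))) * expectation Z)"
    proof -
      have "Re (expectation (\<lambda>\<omega>. indicator A (X \<omega>) * Z \<omega>)) = expectation (\<lambda>\<omega>. Re (indicator A (X \<omega>) * Z \<omega>))"
        by (rule integral_Re[OF intAZ, symmetric])
      also have "\<dots> = expectation (\<lambda>\<omega>. indicator A (X \<omega>)) * expectation (\<lambda>\<omega>. Re (Z \<omega>))"
        by (simp only: RI Re_fact)
      also have "\<dots> = Re (of_real (expectation (\<lambda>\<omega>. indicator A (X \<omega>))) * expectation Z)"
        using intZ by simp
      finally show ?thesis .
    qed
    show "Im (expectation (\<lambda>\<omega>. indicator A (X \<omega>) * Z \<omega>)) =
      Im (of_real (expectation (\<lambda>\<omega>. indicator A (X \<omega>))) * expectation Z)"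
    proof -
      have "Im (expectation (\<lambda>\<omega>. indicator A (X \<omega>) * Z \<omega>)) = expectation (\<lambda>\<omega>. Im (indicator A (X \<omega>) * Z \<omega>))"
        by (rule integral_Im[OF intAZ, symmetric])
      also have "\<dots> = expectation (\<lambda>\<omega>. indicator A (X \<omega>)) * expectation (\<lambda>\<omega>. Im (Z \<omega>))"
        by (simp only: RI Im_fact)
      also have "\<dots> = Im (of_real (expectation (\<lambda>\<omega>. indicator A (X \<omega>))) * expectation Z)"
        using intZ by simp
      finally show ?thesis .
    qed
  qed
qed

text \<open>The exponentials in the joint characteristic function are exchanged for indicators one variable at
a time; each exchange is an instance of the uniqueness theorem on the line.\<close>

lemma (in prob_space) indep_vars_if_char_factors:
  fixes X :: "'i \<Rightarrow> 'a \<Rightarrow> real"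
  assumes X: "\<And>i. i \<in> I \<Longrightarrow> random_variable borel (X i)"
    and factor: "\<And>J u. finite J \<Longrightarrow> J \<subseteq> I \<Longrightarrow>
      char (distr M borel (\<lambda>\<omega>. \<Sum>j\<in>J. u j * X j \<omega>)) 1 = (\<Prod>j\<in>J. char (distr M borel (X j)) (u j))"
  shows "indep_vars (\<lambda>_. borel) X I"
proof -
  \<comment> \<open>\<open>K\<close> indexes the variables already tested against indicators, \<open>L\<close> those still inside an
    exponential. Quantifying over \<open>L\<close> and \<open>u\<close> lets the induction hypothesis for \<open>insert k L\<close> provide
    the premise of the one-variable exchange.\<close>
  have mixed: "expectation (\<lambda>\<omega>. (\<Prod>k\<in>K. indicator (A k) (X k \<omega>)) * (\<Prod>l\<in>L. iexp (u l * X l \<omega>))) =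
      (\<Prod>k\<in>K. of_real (expectation (\<lambda>\<omega>. indicator (A k) (X k \<omega>)))) *
      (\<Prod>l\<in>L. expectation (\<lambda>\<omega>. iexp (u l * X l \<omega>)))"
    if "finite K" "finite L" "K \<inter> L = {}" "K \<union> L \<subseteq> I" "\<And>k. k \<in> K \<Longrightarrow> A k \<in> sets borel"
    for K L :: "'i set" and A u
    using that
  proof (induction K arbitrary: L u)
    case empty
    have [measurable]: "\<And>l. l \<in> L \<Longrightarrow> random_variable borel (X l)" using empty X by auto
    have "char (distr M borel (\<lambda>\<omega>. \<Sum>j\<in>L. u j * X j \<omega>)) 1 =
        expectation (\<lambda>\<omega>. iexp (\<Sum>j\<in>L. u j * X j \<omega>))"
      by (simp add: char_def integral_distr)
    also have "\<dots> = expectation (\<lambda>\<omega>. \<Prod>l\<in>L. iexp (u l * X l \<omega>))"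
      using empty(1) by (simp add: sum_distrib_left exp_sum)
    finally have "expectation (\<lambda>\<omega>. \<Prod>l\<in>L. iexp (u l * X l \<omega>)) = (\<Prod>j\<in>L. char (distr M borel (X j)) (u j))"
      using factor[of L u] empty by simp
    also have "\<dots> = (\<Prod>l\<in>L. expectation (\<lambda>\<omega>. iexp (u l * X l \<omega>)))"
      by (intro prod.cong) (simp_all add: char_def integral_distr)
    finally show ?case by simp
  next
    case (insert k K)
    have mL[measurable]: "\<And>l. l \<in> L \<Longrightarrow> random_variable borel (X l)" using insert.prems X by auto
    have mK[measurable]: "\<And>l. l \<in> K \<Longrightarrow> random_variable borel (X l)" using insert.prems X by auto
    have mA[measurable]: "\<And>l. l \<in> K \<Longrightarrow> A l \<in> sets borel" using insert.prems by auto
    have mk[measurable]: "random_variable borel (X k)" using insert.prems X by auto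
    define Z where "Z = (\<lambda>\<omega>. (\<Prod>k\<in>K. indicator (A k) (X k \<omega>)) * (\<Prod>l\<in>L. iexp (u l * X l \<omega>)))"
    have Zm[measurable]: "random_variable borel Z"
      unfolding Z_def by measurable
    have "norm (\<Prod>k\<in>K. indicator (A k) (X k \<omega>) :: complex) \<le> (\<Prod>k\<in>K. 1)" for \<omega>
      unfolding prod_norm[symmetric] by (rule prod_mono) (auto simp: indicator_def)
    then have bound: "norm (Z \<omega>) \<le> 1" for \<omega>
      unfolding Z_def by (simp add: norm_mult prod_norm[symmetric])
    have kL: "k \<notin> L" using insert by auto
    have Z1: "expectation Z = (\<Prod>k\<in>K. of_real (expectation (\<lambda>\<omega>. indicator (A k) (X k \<omega>)))) *
      (\<Prod>l\<in>L. expectation (\<lambda>\<omega>. iexp (u l * X l \<omega>)))"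
      unfolding Z_def by (rule insert.IH) (use insert in auto)
    have Z2: "expectation (\<lambda>\<omega>. iexp (v * X k \<omega>) * Z \<omega>) =
      expectation (\<lambda>\<omega>. iexp (v * X k \<omega>)) * expectation Z" for v
    proof -
      have eq: "(\<Prod>l\<in>insert k L. iexp ((u(k := v)) l * X l \<omega>)) =
         iexp (v * X k \<omega>) * (\<Prod>l\<in>L. iexp (u l * X l \<omega>))" for \<omega>
        using kL insert.prems by (subst prod.insert) (auto intro!: prod.cong)
      have eq': "(\<Prod>l\<in>insert k L. expectation (\<lambda>\<omega>. iexp ((u(k := v)) l * X l \<omega>))) =
         expectation (\<lambda>\<omega>. iexp (v * X k \<omega>)) * (\<Prod>l\<in>L. expectation (\<lambda>\<omega>. iexp (u l * X l \<omega>)))"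
        using kL insert.prems by (subst prod.insert) (auto intro!: prod.cong)
      have "expectation (\<lambda>\<omega>. (\<Prod>k\<in>K. indicator (A k) (X k \<omega>)) *
          (\<Prod>l\<in>insert k L. iexp ((u(k := v)) l * X l \<omega>))) =
        (\<Prod>k\<in>K. of_real (expectation (\<lambda>\<omega>. indicator (A k) (X k \<omega>)))) *
          (\<Prod>l\<in>insert k L. expectation (\<lambda>\<omega>. iexp ((u(k := v)) l * X l \<omega>)))"
        by (rule insert.IH) (use insert in auto)
      then show ?thesis unfolding eq eq' Z1 by (simp add: Z_def mult_ac)
    qed
    have "expectation (\<lambda>\<omega>. indicator (A k) (X k \<omega>) * Z \<omega>) =
      of_real (expectation (\<lambda>\<omega>. indicator (A k) (X k \<omega>))) * expectation Z"
      by (rule factor_indicator_if_char_factors[of _ _ 1]) (use bound Z2 insert.prems in auto)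
    then show ?case
      using insert.hyps unfolding Z1 by (simp add: Z_def mult.assoc)
  qed
  show ?thesis
    unfolding indep_vars_def2
  proof (intro conjI ballI indep_setsI)
    fix A J
    assume J: "J \<noteq> {}" "J \<subseteq> I" "finite J" and "\<forall>j\<in>J. A j \<in> {X j -` B \<inter> space M |B. B \<in> sets borel}"
    then have "\<forall>j\<in>J. \<exists>B. B \<in> sets borel \<and> A j = X j -` B \<inter> space M" by auto
    then obtain B where B: "\<And>j. j \<in> J \<Longrightarrow> B j \<in> sets borel" "\<And>j. j \<in> J \<Longrightarrow> A j = X j -` B j \<inter> space M"
      by metis
    have ev: "A j \<in> events" if "j \<in> J" for j
      using B[OF that] X[of j] that J by (auto intro: measurable_sets)
    have prA: "prob (A j) = expectation (\<lambda>\<omega>. indicator (B j) (X j \<omega>))" if "j \<in> J" for j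
    proof -
      have "expectation (\<lambda>\<omega>. indicator (B j) (X j \<omega>)) = (expectation (indicator (A j)) :: real)"
        by (rule Bochner_Integration.integral_cong) (use B[OF that] in \<open>auto simp: indicator_def\<close>)
      then show ?thesis using ev[OF that] by simp
    qed
    have INT: "(\<Inter>j\<in>J. A j) \<in> events"
      using J ev by (intro sets.finite_INT) auto
    have "complex_of_real (prob (\<Inter>j\<in>J. A j)) = of_real (expectation (indicator (\<Inter>j\<in>J. A j)))"
      using INT by simp
    also have "\<dots> = expectation (\<lambda>\<omega>. of_real (indicator (\<Inter>j\<in>J. A j) \<omega>))"
      by (rule integral_complex_of_real[symmetric])
    also have "\<dots> = expectation (\<lambda>\<omega>. \<Prod>j\<in>J. indicator (B j) (X j \<omega>))"
    proof (rule Bochner_Integration.integral_cong[OF refl])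
      fix \<omega> assume w: "\<omega> \<in> space M"
      show "complex_of_real (indicator (\<Inter>j\<in>J. A j) \<omega>) = (\<Prod>j\<in>J. indicator (B j) (X j \<omega>))"
      proof (cases "\<forall>j\<in>J. X j \<omega> \<in> B j")
        case True then show ?thesis using w B by (auto simp: indicator_def)
      next
        case False
        then obtain j where j: "j \<in> J" "X j \<omega> \<notin> B j" by auto
        then have "(\<Prod>j\<in>J. indicator (B j) (X j \<omega>)) = (0::complex)"
          using J by (intro prod_zero) (auto simp: indicator_def)
        then show ?thesis using j B by (auto simp: indicator_def)
      qed
    qed
    also have "\<dots> = (\<Prod>j\<in>J. of_real (prob (A j)))"
      using mixed[of J "{}" B] J B prA by simp
    finally show "prob (\<Inter>j\<in>J. A j) = (\<Prod>j\<in>J. prob (A j))"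
      by (simp flip: of_real_prod)
  qed (use X in \<open>auto intro: measurable_sets\<close>)
qed

section \<open>Square-integrable functions\<close>

lemma square_integrable_mult_integrable:
  assumes "square_integrable N f" "square_integrable N g"
  shows "integrable N (\<lambda>x. f x * g x)"
proof (rule Bochner_Integration.integrable_bound)
  show "integrable N (\<lambda>x. (f x)\<^sup>2 + (g x)\<^sup>2)"
    using assms by (simp add: square_integrable_def)
  show "(\<lambda>x. f x * g x) \<in> borel_measurable N"
    using assms by (auto simp: square_integrable_def intro: borel_measurable_times)
  have "\<bar>a * b\<bar> \<le> a\<^sup>2 + b\<^sup>2" for a b :: real
  proof -
    have "0 \<le> \<bar>a * b\<bar>" by simp
    then show ?thesis using sum_squares_bound[of "\<bar>a\<bar>" "\<bar>b\<bar>"] 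
      by (simp add: abs_mult del: zero_le_mult_iff mult_nonneg_nonneg)
  qed
  then show "AE x in N. norm (f x * g x) \<le> norm ((f x)\<^sup>2 + (g x)\<^sup>2)" by simp
qed

lemma square_integrable_add:
  assumes "square_integrable N f" "square_integrable N g"
  shows "square_integrable N (\<lambda>x. f x + g x)"
  using assms square_integrable_mult_integrable[OF assms]
  unfolding square_integrable_def by (auto simp: power2_sum mult.assoc intro: borel_measurable_add)

lemma square_integrable_cmult:
  "square_integrable N f \<Longrightarrow> square_integrable N (\<lambda>x. a * f x)"
  unfolding square_integrable_def
  by (auto simp: power_mult_distrib intro: borel_measurable_times borel_measurable_const)

lemma square_integrable_diff:
  assumes "square_integrable N f" "square_integrable N g"
  shows "square_integrable N (\<lambda>x. f x - g x)"
  using square_integrable_add[OF assms(1) square_integrable_cmult[OF assms(2), of "-1"]] by simp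

lemma integral_sum_square_le:
  assumes "square_integrable N f" "square_integrable N g"
  shows "(LINT x|N. (f x + g x)\<^sup>2) \<le> 2 * (LINT x|N. (f x)\<^sup>2) + 2 * (LINT x|N. (g x)\<^sup>2)"
proof -
  have "(LINT x|N. (f x + g x)\<^sup>2) \<le> (LINT x|N. 2 * (f x)\<^sup>2 + 2 * (g x)\<^sup>2)"
  proof (rule integral_mono)
    show "(f x + g x)\<^sup>2 \<le> 2 * (f x)\<^sup>2 + 2 * (g x)\<^sup>2" for x
      using sum_squares_bound[of "f x" "g x"] by (simp add: power2_sum)
  qed (use assms square_integrable_add[OF assms] in \<open>auto simp: square_integrable_def\<close>)
  also have "\<dots> = 2 * (LINT x|N. (f x)\<^sup>2) + 2 * (LINT x|N. (g x)\<^sup>2)"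
    using assms by (simp add: square_integrable_def)
  finally show ?thesis .
qed

lemma integral_mult_Cauchy_Schwarz:
  assumes f: "square_integrable N f" and g: "square_integrable N g"
  shows "(LINT x|N. f x * g x)\<^sup>2 \<le> (LINT x|N. (f x)\<^sup>2) * (LINT x|N. (g x)\<^sup>2)"
proof -
  define a b c where "a = (LINT x|N. (f x)\<^sup>2)" and "b = (LINT x|N. f x * g x)"
    and "c = (LINT x|N. (g x)\<^sup>2)"
  have quad: "0 \<le> t\<^sup>2 * a - 2 * t * b + c" for t
  proof -
    have "0 \<le> (LINT x|N. (t * f x - g x)\<^sup>2)" by simp
    also have "\<dots> = (LINT x|N. t\<^sup>2 * (f x)\<^sup>2 - 2 * t * (f x * g x) + (g x)\<^sup>2)"
      by (simp add: power2_diff power_mult_distrib algebra_simps)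
    also have "\<dots> = t\<^sup>2 * a - 2 * t * b + c"
      using f g square_integrable_mult_integrable[OF f g]
      unfolding a_def b_def c_def square_integrable_def by simp
    finally show ?thesis .
  qed
  have "a \<ge> 0" unfolding a_def by simp
  then consider "a > 0" | "a = 0" by linarith
  then have "b\<^sup>2 \<le> a * c"
  proof cases
    case 1
    then show ?thesis using quad[of "b / a"] by (simp add: power2_eq_square field_simps)
  next
    case 2
    have "b = 0"
    proof (rule ccontr)
      assume "b \<noteq> 0"
      \<comment> \<open>With \<open>a = 0\<close> the quadratic is affine in \<open>t\<close>; at this \<open>t\<close> it equals \<open>- 1\<close>.\<close>
      then show False using quad[of "(c + 1) / (2 * b)"] 2 by simp
    qed
    then show ?thesis using 2 by simp
  qed
  then show ?thesis unfolding a_def b_def c_def .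
qed

lemma tendsto_L2_add:
  assumes F: "tendsto_L2 N F f" and G: "tendsto_L2 N G g"
  shows "tendsto_L2 N (\<lambda>k x. F k x + G k x) (\<lambda>x. f x + g x)"
  unfolding tendsto_L2_def
proof (intro conjI allI)
  have sq: "square_integrable N (F k)" "square_integrable N f"
    "square_integrable N (G k)" "square_integrable N g" for k
    using F G by (auto simp: tendsto_L2_def)
  then show "square_integrable N (\<lambda>x. F k x + G k x)" "square_integrable N (\<lambda>x. f x + g x)" for k
    by (auto intro: square_integrable_add)
  let ?u = "\<lambda>k. 2 * (LINT x|N. (F k x - f x)\<^sup>2) + 2 * (LINT x|N. (G k x - g x)\<^sup>2)"
  show "(\<lambda>k. LINT x|N. (F k x + G k x - (f x + g x))\<^sup>2) \<longlonglongrightarrow> 0"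
  proof (rule tendsto_sandwich[of "\<lambda>_. 0" _ _ ?u])
    have "?u \<longlonglongrightarrow> 2 * 0 + 2 * 0"
      using F G unfolding tendsto_L2_def by (intro tendsto_intros) auto
    then show "?u \<longlonglongrightarrow> 0" by simp
    have "(LINT x|N. (F k x + G k x - (f x + g x))\<^sup>2) \<le> ?u k" for k
      using integral_sum_square_le[OF square_integrable_diff[OF sq(1,2)] square_integrable_diff[OF sq(3,4)]]
      by (simp add: algebra_simps)
    then show "\<forall>\<^sub>F k in sequentially. (LINT x|N. (F k x + G k x - (f x + g x))\<^sup>2) \<le> ?u k" by simp
  qed auto
qed

lemma tendsto_L2_cmult:
  assumes F: "tendsto_L2 N F f"
  shows "tendsto_L2 N (\<lambda>k x. a * F k x) (\<lambda>x. a * f x)"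
proof -
  have "(LINT x|N. (a * F k x - a * f x)\<^sup>2) = a\<^sup>2 * (LINT x|N. (F k x - f x)\<^sup>2)" for k
    by (simp flip: right_diff_distrib add: power_mult_distrib)
  moreover have "(\<lambda>k. a\<^sup>2 * (LINT x|N. (F k x - f x)\<^sup>2)) \<longlonglongrightarrow> a\<^sup>2 * 0"
    using F unfolding tendsto_L2_def by (intro tendsto_intros) auto
  ultimately show ?thesis
    using F unfolding tendsto_L2_def by (auto intro: square_integrable_cmult)
qed

lemma tendsto_L2_sum:
  assumes "\<And>j. j \<in> J \<Longrightarrow> tendsto_L2 N (F j) (f j)"
  shows "tendsto_L2 N (\<lambda>k x. \<Sum>j\<in>J. u j * F j k x) (\<lambda>x. \<Sum>j\<in>J. u j * f j x)"
  using assms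
proof (induction J rule: infinite_finite_induct)
  case (insert j J)
  then show ?case by (simp add: tendsto_L2_add tendsto_L2_cmult)
qed (simp_all add: tendsto_L2_def square_integrable_def)

lemma tendsto_L2_integral_square:
  assumes F: "tendsto_L2 N F f"
  shows "(\<lambda>k. LINT x|N. (F k x)\<^sup>2) \<longlonglongrightarrow> (LINT x|N. (f x)\<^sup>2)"
proof -
  have sq: "square_integrable N (F k)" "square_integrable N f" for k
    using F by (auto simp: tendsto_L2_def)
  let ?d = "\<lambda>k x. F k x - f x"
  have dsq: "square_integrable N (?d k)" for k
    by (intro square_integrable_diff sq)
  have d0: "(\<lambda>k. LINT x|N. (?d k x)\<^sup>2) \<longlonglongrightarrow> 0" using F unfolding tendsto_L2_def by simp
  have "(\<lambda>k. LINT x|N. ?d k x * f x) \<longlonglongrightarrow> 0"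
  proof (rule Lim_null_comparison)
    have "norm (LINT x|N. ?d k x * f x) \<le> sqrt ((LINT x|N. (?d k x)\<^sup>2) * (LINT x|N. (f x)\<^sup>2))" for k
      using integral_mult_Cauchy_Schwarz[OF dsq sq(2), of k] by (intro real_le_rsqrt) simp
    then show "\<forall>\<^sub>F k in sequentially. norm (LINT x|N. ?d k x * f x) \<le>
        sqrt ((LINT x|N. (?d k x)\<^sup>2) * (LINT x|N. (f x)\<^sup>2))" by simp
    have "(\<lambda>k. sqrt ((LINT x|N. (?d k x)\<^sup>2) * (LINT x|N. (f x)\<^sup>2))) \<longlonglongrightarrow> sqrt (0 * (LINT x|N. (f x)\<^sup>2))"
      by (intro tendsto_intros d0)
    then show "(\<lambda>k. sqrt ((LINT x|N. (?d k x)\<^sup>2) * (LINT x|N. (f x)\<^sup>2))) \<longlonglongrightarrow> 0" by simp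
  qed
  then have "(\<lambda>k. (LINT x|N. (?d k x)\<^sup>2) + 2 * (LINT x|N. ?d k x * f x) + (LINT x|N. (f x)\<^sup>2))
      \<longlonglongrightarrow> 0 + 2 * 0 + (LINT x|N. (f x)\<^sup>2)"
    by (intro tendsto_intros d0)
  moreover have "(LINT x|N. (F k x)\<^sup>2) =
      (LINT x|N. (?d k x)\<^sup>2) + 2 * (LINT x|N. ?d k x * f x) + (LINT x|N. (f x)\<^sup>2)" for k
  proof -
    have "(LINT x|N. (F k x)\<^sup>2) = (LINT x|N. (?d k x)\<^sup>2 + 2 * (?d k x * f x) + (f x)\<^sup>2)"
      by (rule Bochner_Integration.integral_cong) (auto simp: power2_eq_square algebra_simps)
    also have "\<dots> = (LINT x|N. (?d k x)\<^sup>2) + 2 * (LINT x|N. ?d k x * f x) + (LINT x|N. (f x)\<^sup>2)"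
      using dsq[of k] sq square_integrable_mult_integrable[OF dsq sq(2), of k]
      unfolding square_integrable_def by (simp del: power2_diff)
    finally show ?thesis .
  qed
  ultimately show ?thesis by simp
qed

lemma (in prob_space) integral_abs_le_L2:
  assumes Y: "square_integrable M Y"
  shows "integrable M Y" "(LINT x|M. \<bar>Y x\<bar>) \<le> sqrt (LINT x|M. (Y x)\<^sup>2)"
proof -
  have abs: "square_integrable M (\<lambda>x. \<bar>Y x\<bar>)" "square_integrable M (\<lambda>x. 1)"
    using Y by (auto simp: square_integrable_def)
  show "integrable M Y"
    using Y unfolding square_integrable_def by (blast intro: square_integrable_imp_integrable)
  show "(LINT x|M. \<bar>Y x\<bar>) \<le> sqrt (LINT x|M. (Y x)\<^sup>2)"
    using integral_mult_Cauchy_Schwarz[OF abs] by (intro real_le_rsqrt) (simp add: prob_space)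
qed

text \<open>The map \<open>x \<mapsto> exp (\<i> u x)\<close> is Lipschitz with constant \<open>\<bar>u\<bar>\<close>, and the first absolute moment is at most
the \<open>L\<^sup>2\<close> norm.\<close>

lemma (in prob_space) tendsto_L2_char:
  assumes Y: "tendsto_L2 M Y X"
  shows "(\<lambda>k. char (distr M borel (Y k)) u) \<longlonglongrightarrow> char (distr M borel X) u"
proof -
  have sq: "square_integrable M (Y k)" "square_integrable M X" for k
    using Y by (auto simp: tendsto_L2_def)
  have [measurable]: "Y k \<in> borel_measurable M" "X \<in> borel_measurable M" for k
    using sq by (auto simp: square_integrable_def)
  have lip: "norm (iexp a - iexp b) \<le> \<bar>a - b\<bar>" for a b
  proof -
    have "iexp a - iexp b = iexp b * (iexp (a - b) - 1)"
      by (simp add: right_diff_distrib flip: exp_add)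
    then have "norm (iexp a - iexp b) = norm (iexp (a - b) - 1)" by (simp add: norm_mult)
    also have "\<dots> \<le> \<bar>a - b\<bar>" using iexp_approx1[of "a - b" 0] by simp
    finally show ?thesis .
  qed
  have int: "integrable M (\<lambda>x. iexp (u * Z x))" if [measurable]: "Z \<in> borel_measurable M" for Z
    by (rule integrable_const_bound[of _ 1]) auto
  have le: "norm (char (distr M borel (Y k)) u - char (distr M borel X) u) \<le>
      \<bar>u\<bar> * sqrt (LINT x|M. (Y k x - X x)\<^sup>2)" for k
  proof -
    have D: "square_integrable M (\<lambda>x. Y k x - X x)" by (intro square_integrable_diff sq)
    have "norm (char (distr M borel (Y k)) u - char (distr M borel X) u) =
        norm (expectation (\<lambda>x. iexp (u * Y k x) - iexp (u * X x)))"
      using int[of "Y k"] int[of X] by (simp add: char_def integral_distr)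
    also have "\<dots> \<le> expectation (\<lambda>x. norm (iexp (u * Y k x) - iexp (u * X x)))"
      by (rule integral_norm_bound)
    also have "\<dots> \<le> expectation (\<lambda>x. \<bar>u\<bar> * \<bar>Y k x - X x\<bar>)"
    proof (rule integral_mono)
      show "norm (iexp (u * Y k x) - iexp (u * X x)) \<le> \<bar>u\<bar> * \<bar>Y k x - X x\<bar>" for x
        using lip[of "u * Y k x" "u * X x"] by (simp add: abs_mult flip: right_diff_distrib)
    qed (use int[of "Y k"] int[of X] integral_abs_le_L2(1)[OF D] in auto)
    also have "\<dots> \<le> \<bar>u\<bar> * sqrt (LINT x|M. (Y k x - X x)\<^sup>2)"
      using integral_abs_le_L2(2)[OF D] by (simp add: mult_left_mono)
    finally show ?thesis .
  qed
  have "(\<lambda>k. \<bar>u\<bar> * sqrt (LINT x|M. (Y k x - X x)\<^sup>2)) \<longlonglongrightarrow> \<bar>u\<bar> * sqrt 0"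
    using Y unfolding tendsto_L2_def by (intro tendsto_intros) auto
  then have "(\<lambda>k. \<bar>u\<bar> * sqrt (LINT x|M. (Y k x - X x)\<^sup>2)) \<longlonglongrightarrow> 0" by simp
  then have "(\<lambda>k. char (distr M borel (Y k)) u - char (distr M borel X) u) \<longlonglongrightarrow> 0"
    by (rule Lim_null_comparison[rotated]) (use le in auto)
  then show ?thesis by (rule Lim_null[THEN iffD2])
qed

text \<open>Being Cauchy in \<open>L\<^sup>2\<close>, the sequence is Cauchy in \<open>L\<^sup>1\<close>, so a subsequence converges almost surely.
Its limit is the \<open>L\<^sup>2\<close> limit of the whole sequence by Fatou's lemma.\<close>

lemma (in prob_space) L2_complete:
  assumes sq: "\<And>k. square_integrable M (Y k)"
    and Cauchy: "\<And>e. e > 0 \<Longrightarrow> \<exists>N. \<forall>i\<ge>N. \<forall>j\<ge>N. (LINT x|M. (Y i x - Y j x)\<^sup>2) < e"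
  obtains X where "tendsto_L2 M Y X"
proof -
  have m[measurable]: "Y k \<in> borel_measurable M" for k
    using sq by (auto simp: square_integrable_def)
  have dsq: "square_integrable M (\<lambda>x. Y i x - Y j x)" for i j
    by (intro square_integrable_diff sq)
  have L1: "\<exists>N. \<forall>i\<ge>N. \<forall>j\<ge>N. (LINT x|M. norm (Y i x - Y j x)) < e" if "e > 0" for e :: real
  proof -
    obtain N where N: "\<And>i j. i \<ge> N \<Longrightarrow> j \<ge> N \<Longrightarrow> (LINT x|M. (Y i x - Y j x)\<^sup>2) < e\<^sup>2"
      using Cauchy[of "e\<^sup>2"] \<open>e > 0\<close> by auto
    have "(LINT x|M. norm (Y i x - Y j x)) < e" if "i \<ge> N" "j \<ge> N" for i j
    proof -
      have "(LINT x|M. norm (Y i x - Y j x)) \<le> sqrt (LINT x|M. (Y i x - Y j x)\<^sup>2)"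
        using integral_abs_le_L2(2)[OF dsq] by simp
      also have "\<dots> < e" using N[OF that] \<open>e > 0\<close> by (intro real_less_lsqrt) auto
      finally show ?thesis .
    qed
    then show ?thesis by blast
  qed
  obtain r where r: "strict_mono r" and AEC: "AE x in M. Cauchy (\<lambda>i. Y (r i) x)"
    using cauchy_L1_AE_cauchy_subseq[OF integral_abs_le_L2(1)[OF sq] L1] by blast
  define X where "X = (\<lambda>x. lim (\<lambda>i. Y (r i) x))"
  have [measurable]: "X \<in> borel_measurable M" unfolding X_def by measurable
  have conv: "AE x in M. (\<lambda>i. Y (r i) x) \<longlonglongrightarrow> X x"
    using AEC unfolding X_def by eventually_elim (simp add: Cauchy_convergent convergent_LIMSEQ_iff[symmetric])
  have fatou: "(\<integral>\<^sup>+x. ennreal ((Y k x - X x)\<^sup>2) \<partial>M) \<le> ennreal e"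
    if N: "\<And>i. i \<ge> N \<Longrightarrow> (LINT x|M. (Y k x - Y i x)\<^sup>2) \<le> e" for k N and e :: real
  proof -
    have "(\<integral>\<^sup>+x. ennreal ((Y k x - X x)\<^sup>2) \<partial>M) = (\<integral>\<^sup>+x. liminf (\<lambda>i. ennreal ((Y k x - Y (r i) x)\<^sup>2)) \<partial>M)"
    proof (rule nn_integral_cong_AE, use conv in eventually_elim)
      case (elim x)
      then have "(\<lambda>i. ennreal ((Y k x - Y (r i) x)\<^sup>2)) \<longlonglongrightarrow> ennreal ((Y k x - X x)\<^sup>2)"
        by (intro tendsto_intros tendsto_ennrealI)
      then show ?case by (rule lim_imp_Liminf[OF sequentially_bot, symmetric])
    qed
    also have "\<dots> \<le> liminf (\<lambda>i. \<integral>\<^sup>+x. ennreal ((Y k x - Y (r i) x)\<^sup>2) \<partial>M)"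
      by (rule nn_integral_liminf) measurable
    also have "\<dots> \<le> liminf (\<lambda>i. ennreal e)"
    proof (rule Liminf_mono, rule eventually_mono[OF eventually_ge_at_top[of N]])
      fix i assume "N \<le> i"
      then have "r i \<ge> N" using seq_suble[OF r, of i] by linarith
      have "(\<integral>\<^sup>+x. ennreal ((Y k x - Y (r i) x)\<^sup>2) \<partial>M) = ennreal (LINT x|M. (Y k x - Y (r i) x)\<^sup>2)"
        using dsq[of k "r i"] by (intro nn_integral_eq_integral) (auto simp: square_integrable_def)
      then show "(\<integral>\<^sup>+x. ennreal ((Y k x - Y (r i) x)\<^sup>2) \<partial>M) \<le> ennreal e"
        using N[OF \<open>r i \<ge> N\<close>] by (simp add: ennreal_leI)
    qed
    also have "\<dots> = ennreal e" by (simp add: Liminf_const)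
    finally show ?thesis .
  qed
  have Xint: "integrable M (\<lambda>x. (Y k x - X x)\<^sup>2)" if "k \<ge> N"
    "\<And>i j. i \<ge> N \<Longrightarrow> j \<ge> N \<Longrightarrow> (LINT x|M. (Y i x - Y j x)\<^sup>2) < e" for k N e
  proof (rule integrableI_bounded)
    have "(\<integral>\<^sup>+x. ennreal ((Y k x - X x)\<^sup>2) \<partial>M) \<le> ennreal e"
      by (rule fatou[of N]) (use that less_imp_le in blast)
    also have "\<dots> < \<infinity>" by simp
    finally show "(\<integral>\<^sup>+x. ennreal (norm ((Y k x - X x)\<^sup>2)) \<partial>M) < \<infinity>" by simp
  qed measurable
  have Xsq: "square_integrable M X"
  proof -
    obtain N where N: "\<And>i j. i \<ge> N \<Longrightarrow> j \<ge> N \<Longrightarrow> (LINT x|M. (Y i x - Y j x)\<^sup>2) < 1"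
      using Cauchy[of 1] by auto
    have "square_integrable M (\<lambda>x. Y N x - X x)"
      unfolding square_integrable_def using Xint[of N N 1] N by simp
    from square_integrable_diff[OF sq[of N] this] show ?thesis by simp
  qed
  have "(\<lambda>k. LINT x|M. (Y k x - X x)\<^sup>2) \<longlonglongrightarrow> 0"
  proof (rule LIMSEQ_I)
    fix e :: real assume "e > 0"
    obtain N where N: "\<And>i j. i \<ge> N \<Longrightarrow> j \<ge> N \<Longrightarrow> (LINT x|M. (Y i x - Y j x)\<^sup>2) < e / 2"
      using Cauchy[of "e / 2"] \<open>e > 0\<close> by auto
    have "norm ((LINT x|M. (Y k x - X x)\<^sup>2) - 0) < e" if "k \<ge> N" for k
    proof -
      have "ennreal (LINT x|M. (Y k x - X x)\<^sup>2) = (\<integral>\<^sup>+x. ennreal ((Y k x - X x)\<^sup>2) \<partial>M)"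
        using Xint[of N k "e / 2"] N that by (intro nn_integral_eq_integral[symmetric]) auto
      also have "\<dots> \<le> ennreal (e / 2)"
        by (rule fatou[of N]) (use that N less_imp_le in blast)
      finally have "(LINT x|M. (Y k x - X x)\<^sup>2) \<le> e / 2"
        using \<open>e > 0\<close> by (subst (asm) ennreal_le_iff) auto
      then show ?thesis using \<open>e > 0\<close> by simp
    qed
    then show "\<exists>N. \<forall>k\<ge>N. norm ((LINT x|M. (Y k x - X x)\<^sup>2) - 0) < e" by blast
  qed
  with sq Xsq have "tendsto_L2 M Y X" by (simp add: tendsto_L2_def)
  then show ?thesis by (rule that)
qed

section \<open>Partitions and step functions\<close>

lemma partition_of_less:
  assumes "partition_of a b n t" "i < j" "j \<le> n"
  shows "t i < t j"
  using assms(2,3)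
proof (induction j)
  case (Suc j)
  have "t j < t (Suc j)" using assms(1) Suc.prems by (simp add: partition_of_def)
  then show ?case using Suc by (cases "i = j") auto
qed simp

lemma partition_of_less_iff:
  assumes "partition_of a b n t" "i \<le> n" "j \<le> n"
  shows "t i < t j \<longleftrightarrow> i < j" "t i \<le> t j \<longleftrightarrow> i \<le> j"
  using partition_of_less[OF assms(1), of i j] partition_of_less[OF assms(1), of j i] assms(2,3)
  by (cases i j rule: linorder_cases; force)+

lemma partition_of_range:
  assumes "partition_of a b n t" "i \<le> n"
  shows "a \<le> t i" "t i \<le> b"
  using partition_of_less_iff(2)[OF assms(1), of 0 i] partition_of_less_iff(2)[OF assms(1), of i n] assms
  by (auto simp: partition_of_def)

lemma step_fun_eq:
  assumes part: "partition_of a b n t" and i: "i < n" and x: "x \<in> {t i<..t (Suc i)}"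
  shows "step_fun n t y x = y i"
proof -
  have "y j * indicator {t j<..t (Suc j)} x = (if j = i then y i else 0)" if "j < n" for j
  proof (cases i j rule: linorder_cases)
    case less
    then have "t (Suc i) \<le> t j" using partition_of_less_iff(2)[OF part] that i by simp
    then show ?thesis using x less by (simp add: indicator_def)
  next
    case greater
    then have "t (Suc j) \<le> t i" using partition_of_less_iff(2)[OF part] that i by simp
    then show ?thesis using x greater by (simp add: indicator_def)
  qed (use x in auto)
  then have "step_fun n t y x = (\<Sum>j<n. if j = i then y i else 0)"
    unfolding step_fun_def by (intro sum.cong) auto
  then show ?thesis using i by simp
qed

lemma step_fun_outside:
  assumes "\<And>i. i < n \<Longrightarrow> x \<notin> {t i<..t (Suc i)}"
  shows "step_fun n t y x = 0"
  unfolding step_fun_def using assms by (intro sum.neutral) auto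

lemma step_fun_power2:
  assumes "partition_of a b n t"
  shows "(step_fun n t y x)\<^sup>2 = step_fun n t (\<lambda>i. (y i)\<^sup>2) x"
proof (cases "\<exists>i<n. x \<in> {t i<..t (Suc i)}")
  case True
  then obtain i where "i < n" "x \<in> {t i<..t (Suc i)}" by blast
  then show ?thesis by (simp add: step_fun_eq[OF assms])
next
  case False
  then have "step_fun n t z x = 0" for z by (intro step_fun_outside) auto
  then show ?thesis by simp
qed

lemma partition_of_cell:
  assumes part: "partition_of a b n t" and x: "a < x" "x \<le> b"
  obtains i where "i < n" "x \<in> {t i<..t (Suc i)}"
proof -
  define m where "m = (LEAST i. x \<le> t i)"
  have n: "x \<le> t n" using part x by (simp add: partition_of_def)
  then have m: "x \<le> t m" "m \<le> n" unfolding m_def by (auto intro: LeastI Least_le)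
  have "m \<noteq> 0"
  proof
    assume "m = 0"
    with m(1) x(1) part show False by (simp add: partition_of_def)
  qed
  then obtain i where i: "m = Suc i" by (cases m) auto
  have "\<not> x \<le> t i" using not_less_Least[of i "\<lambda>i. x \<le> t i"] i unfolding m_def[symmetric] by simp
  with m i show ?thesis by (intro that[of i]) auto
qed

text \<open>A step function, evaluated at a fixed point, is itself a step integral, of the deterministic
process that jumps from 0 to 1 at this point. Hence identities proved for step integrals of
arbitrary processes hold for step functions as well.\<close>

lemma step_fun_eq_step_integral:
  assumes "partition_of a b n t"
  shows "step_fun n t y x = step_integral (\<lambda>r _. indicator {x..} r) n t y \<omega>"
proof -
  have "(indicator {t i<..t (Suc i)} x :: real) = indicator {x..} (t (Suc i)) - indicator {x..} (t i)"
    if "i < n" for i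
    using assms that unfolding partition_of_def by (force simp: indicator_def)
  then show ?thesis unfolding step_fun_def step_integral_def by simp
qed

text \<open>On each cell of the coarse partition the increments over the cells of the fine one telescope. A
fine cell lies in a coarse one precisely if its right end point does, which is why the new
coefficients are the values at the right end points.\<close>

lemma step_integral_refine:
  assumes t: "partition_of a b n t" and s: "partition_of a b m s"
    and sub: "t ` {..n} \<subseteq> s ` {..m}"
  shows "step_integral W m s (\<lambda>l. step_fun n t y (s (Suc l))) \<omega> = step_integral W n t y \<omega>"
proof -
  let ?d = "\<lambda>l. W (s (Suc l)) \<omega> - W (s l) \<omega>"
  have cell: "(\<Sum>l<m. indicator {t i<..t (Suc i)} (s (Suc l)) * ?d l) = W (t (Suc i)) \<omega> - W (t i) \<omega>"
    if i: "i < n" for i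
  proof -
    have "t i \<in> s ` {..m}" "t (Suc i) \<in> s ` {..m}" using sub i by auto
    then obtain p q where p: "p \<le> m" "t i = s p" and q: "q \<le> m" "t (Suc i) = s q" by auto
    have "p < q" using t i p q partition_of_less_iff[OF s p(1) q(1)] by (auto simp: partition_of_def)
    have "indicator {t i<..t (Suc i)} (s (Suc l)) * ?d l = (if l \<in> {p..<q} then ?d l else 0)" if "l < m" for l
      using that p q partition_of_less_iff(1)[OF s p(1), of "Suc l"]
        partition_of_less_iff(2)[OF s _ q(1), of "Suc l"] by (auto simp: indicator_def)
    then have "(\<Sum>l<m. indicator {t i<..t (Suc i)} (s (Suc l)) * ?d l) = (\<Sum>l<m. if l \<in> {p..<q} then ?d l else 0)"
      by (intro sum.cong) auto
    also have "\<dots> = (\<Sum>l\<in>{..<m} \<inter> {p..<q}. ?d l)"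
      by (simp only: sum.inter_restrict finite_lessThan)
    also have "{..<m} \<inter> {p..<q} = {p..<q}" using q by auto
    also have "(\<Sum>l\<in>{p..<q}. ?d l) = W (s q) \<omega> - W (s p) \<omega>"
      using sum_Suc_diff'[of p q "\<lambda>l. W (s l) \<omega>"] \<open>p < q\<close> by simp
    finally show ?thesis using p q by simp
  qed
  have "step_integral W m s (\<lambda>l. step_fun n t y (s (Suc l))) \<omega> =
      (\<Sum>l<m. \<Sum>i<n. y i * (indicator {t i<..t (Suc i)} (s (Suc l)) * ?d l))"
    unfolding step_integral_def step_fun_def by (simp only: sum_distrib_right mult.assoc)
  also have "\<dots> = (\<Sum>i<n. y i * (\<Sum>l<m. indicator {t i<..t (Suc i)} (s (Suc l)) * ?d l))"
    by (subst sum.swap) (simp only: sum_distrib_left)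
  also have "\<dots> = step_integral W n t y \<omega>"
    unfolding step_integral_def using cell by (intro sum.cong) auto
  finally show ?thesis .
qed

lemma partition_of_finite_set:
  assumes "finite P" "a \<in> P" "b \<in> P" "P \<subseteq> {a..b}" "a < b"
  obtains n t where "partition_of a b n t" "t ` {..n} = P"
proof -
  define xs where "xs = sorted_list_of_set P"
  have xs: "set xs = P" "sorted_wrt (<) xs"
    using assms(1) by (auto simp: xs_def strict_sorted_iff)
  have ne: "xs \<noteq> []" using xs assms by auto
  have len: "i < length xs \<longleftrightarrow> i \<le> length xs - 1" for i using ne by (cases xs) auto
  have less: "xs ! i < xs ! j" if "i < j" "j < length xs" for i j
    using sorted_wrt_nth_less[OF xs(2)] that by blast
  have img: "(!) xs ` {..length xs - 1} = P"
    using xs(1) by (auto simp: set_conv_nth len image_iff)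
  have range: "xs ! i \<in> {a..b}" if "i < length xs" for i
    using that xs(1) assms(4) nth_mem by blast
  obtain i where i: "i < length xs" "xs ! i = a" using xs(1) assms(2) by (auto simp: in_set_conv_nth)
  obtain j where j: "j < length xs" "xs ! j = b" using xs(1) assms(3) by (auto simp: in_set_conv_nth)
  have "i = 0" using less[of 0 i] range[of 0] i ne by (cases i) auto
  moreover have "j = length xs - 1"
  proof (rule ccontr)
    assume "j \<noteq> length xs - 1"
    then have "j < length xs - 1" "length xs - 1 < length xs" using j by linarith+
    then show False using less[of j "length xs - 1"] range[of "length xs - 1"] j by auto
  qed
  ultimately have "partition_of a b (length xs - 1) ((!) xs)"
    using i j less unfolding partition_of_def by auto
  then show ?thesis using img that by blast
qed

text \<open>All partitions are refined to the one formed by the union of their points. The coefficients \<open>z\<close>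
serve the functions and the integrals simultaneously.\<close>

lemma step_linear_combination:
  assumes J: "finite J" and ab: "a < b"
    and part: "\<And>j. j \<in> J \<Longrightarrow> partition_of a b (n j) (t j)"
  obtains m s z where "partition_of a b m s"
    "\<And>x. step_fun m s z x = (\<Sum>j\<in>J. u j * step_fun (n j) (t j) (y j) x)"
    "\<And>\<omega>. step_integral W m s z \<omega> = (\<Sum>j\<in>J. u j * step_integral W (n j) (t j) (y j) \<omega>)"
proof -
  define P where "P = {a, b} \<union> (\<Union>j\<in>J. t j ` {..n j})"
  have "finite P" "a \<in> P" "b \<in> P" using J by (auto simp: P_def)
  moreover have "P \<subseteq> {a..b}"
    unfolding P_def using ab partition_of_range[OF part] by auto
  ultimately obtain m s where s: "partition_of a b m s" and sP: "s ` {..m} = P"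
    using partition_of_finite_set[OF _ _ _ _ ab] by metis
  have sub: "t j ` {..n j} \<subseteq> s ` {..m}" if "j \<in> J" for j
    unfolding sP P_def using that by auto
  define z where "z = (\<lambda>l. \<Sum>j\<in>J. u j * step_fun (n j) (t j) (y j) (s (Suc l)))"
  have int: "step_integral V m s z \<omega> = (\<Sum>j\<in>J. u j * step_integral V (n j) (t j) (y j) \<omega>)"
    for V :: "real \<Rightarrow> 'c \<Rightarrow> real" and \<omega>
  proof -
    have "step_integral V m s z \<omega> =
        (\<Sum>j\<in>J. u j * step_integral V m s (\<lambda>l. step_fun (n j) (t j) (y j) (s (Suc l))) \<omega>)"
      unfolding step_integral_def z_def
      by (simp add: sum_distrib_left sum_distrib_right mult.assoc) (rule sum.swap)
    also have "\<dots> = (\<Sum>j\<in>J. u j * step_integral V (n j) (t j) (y j) \<omega>)"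
      by (intro sum.cong refl arg_cong2[where f = "(*)"] step_integral_refine[OF part s sub])
    finally show ?thesis .
  qed
  have "step_fun m s z x = (\<Sum>j\<in>J. u j * step_fun (n j) (t j) (y j) x)" for x
  proof -
    have "step_fun m s z x = step_integral (\<lambda>r _. indicator {x..} r) m s z ()"
      by (rule step_fun_eq_step_integral[OF s])
    also have "\<dots> = (\<Sum>j\<in>J. u j * step_integral (\<lambda>r _. indicator {x..} r) (n j) (t j) (y j) ())"
      by (rule int)
    also have "\<dots> = (\<Sum>j\<in>J. u j * step_fun (n j) (t j) (y j) x)"
    proof (intro sum.cong refl)
      fix j assume "j \<in> J"
      show "u j * step_integral (\<lambda>r _. indicator {x..} r) (n j) (t j) (y j) () = u j * step_fun (n j) (t j) (y j) x"
        by (simp only: step_fun_eq_step_integral[OF part[OF \<open>j \<in> J\<close>], of "y j" x "()"])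
    qed
    finally show ?thesis .
  qed
  from that[OF s this int] show ?thesis .
qed

lemma borel_measurable_step_fun:
  "step_fun n t y \<in> borel_measurable (lebesgue_on S)"
proof -
  have "step_fun n t y \<in> borel_measurable borel"
    unfolding step_fun_def by measurable
  then show ?thesis
    by (intro measurable_restrict_space1 measurable_completion) simp
qed

lemma measure_partition_cell:
  assumes part: "partition_of a b n t" and i: "i < n"
  shows "measure lebesgue ({a<..<b} \<inter> {t i<..t (Suc i)}) = t (Suc i) - t i"
    "{a<..<b} \<inter> {t i<..t (Suc i)} \<in> lmeasurable"
proof -
  have le: "a \<le> t i" "t i < t (Suc i)" "t (Suc i) \<le> b"
    using partition_of_range[OF part] partition_of_less[OF part, of i "Suc i"] i by auto
  have "{a<..<b} \<inter> {t i<..t (Suc i)} = {t i<..t (Suc i)} \<or>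
      {a<..<b} \<inter> {t i<..t (Suc i)} = {t i<..<t (Suc i)}"
    using le by (cases "t (Suc i) = b") auto
  then show "measure lebesgue ({a<..<b} \<inter> {t i<..t (Suc i)}) = t (Suc i) - t i"
    "{a<..<b} \<inter> {t i<..t (Suc i)} \<in> lmeasurable"
    using le by (auto simp: fmeasurable_def)
qed

lemma integral_step_fun:
  assumes part: "partition_of a b n t"
  shows "integrable (lebesgue_on {a<..<b}) (step_fun n t y)"
    "(LINT x|lebesgue_on {a<..<b}. step_fun n t y x) = (\<Sum>i<n. y i * (t (Suc i) - t i))"
proof -
  have ind: "indicator {a<..<b} x * indicator {t i<..t (Suc i)} x =
      (indicator ({a<..<b} \<inter> {t i<..t (Suc i)}) x :: real)" for i x
    by (simp add: indicator_def)
  have 1: "integrable (lebesgue_on {a<..<b}) (indicator {t i<..t (Suc i)} :: real \<Rightarrow> real)" if "i < n" for i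
    using measure_partition_cell[OF part that]
    by (subst integrable_restrict_space) (simp_all add: ind fmeasurable_def)
  have 2: "(LINT x|lebesgue_on {a<..<b}. indicator {t i<..t (Suc i)} x) = t (Suc i) - t i" if "i < n" for i
    using measure_partition_cell[OF part that]
    by (subst integral_restrict_space) (simp_all add: ind)
  have eq: "step_fun n t y = (\<lambda>x. \<Sum>i<n. y i * indicator {t i<..t (Suc i)} x)"
    by (simp add: step_fun_def fun_eq_iff del: sum_mult_indicator)
  show "integrable (lebesgue_on {a<..<b}) (step_fun n t y)"
    unfolding eq using 1 by (intro Bochner_Integration.integrable_sum integrable_mult_right) auto
  have "(LINT x|lebesgue_on {a<..<b}. step_fun n t y x) =
      (\<Sum>i<n. LINT x|lebesgue_on {a<..<b}. y i * indicator {t i<..t (Suc i)} x)"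
    unfolding eq using 1 by (intro Bochner_Integration.integral_sum integrable_mult_right) auto
  also have "\<dots> = (\<Sum>i<n. y i * (t (Suc i) - t i))"
    using 2 by (intro sum.cong) auto
  finally show "(LINT x|lebesgue_on {a<..<b}. step_fun n t y x) = (\<Sum>i<n. y i * (t (Suc i) - t i))" .
qed

lemma square_integrable_step_fun:
  assumes "partition_of a b n t"
  shows "square_integrable (lebesgue_on {a<..<b}) (step_fun n t y)"
  unfolding square_integrable_def step_fun_power2[OF assms]
  using integral_step_fun(1)[OF assms] borel_measurable_step_fun by blast

section \<open>Step integrals and the Wiener integral\<close>

text \<open>The normalised variable \<open>X / \<sigma>\<close> is standard normal.\<close>

lemma (in prob_space) char_normal:
  assumes X: "distributed M lborel X (normal_density 0 \<sigma>)" and \<sigma>: "\<sigma> > 0"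
  shows "char (distr M borel X) v = exp (- (v\<^sup>2 * \<sigma>\<^sup>2 / 2))"
proof -
  let ?Y = "\<lambda>\<omega>. X \<omega> / \<sigma>"
  have [measurable]: "X \<in> borel_measurable M"
    using distributed_measurable[OF X] by simp
  have "distributed M lborel ?Y std_normal_density"
    using normal_standard_normal_convert[OF \<sigma>, of X 0] X by simp
  then have "distr M lborel ?Y = std_normal_distribution"
    by (rule distributed_distr_eq_density)
  then have Y: "distr M borel ?Y = std_normal_distribution"
    by (subst distr_cong[of M M borel lborel ?Y ?Y]) auto
  have "char (distr M borel X) v = expectation (\<lambda>\<omega>. iexp ((v * \<sigma>) * ?Y \<omega>))"
    using \<sigma> by (simp add: char_def integral_distr)
  also have "\<dots> = char (distr M borel ?Y) (v * \<sigma>)"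
    by (simp only: char_def, subst integral_distr) auto
  also have "\<dots> = exp (- (v\<^sup>2 * \<sigma>\<^sup>2 / 2))"
    unfolding Y char_std_normal_distribution by (simp add: power_mult_distrib)
  finally show ?thesis .
qed

text \<open>The characteristic function determines the law, so integrability and moments can be read off from
a standard normal variable multiplied by \<open>sqrt v\<close>. The degenerate case \<open>v = 0\<close> occurs for step
integrals with vanishing coefficients.\<close>

lemma (in prob_space) second_moment_of_normal_char:
  assumes Y[measurable]: "Y \<in> borel_measurable M" and v: "v \<ge> 0"
    and char: "\<And>u. char (distr M borel Y) u = exp (- (u\<^sup>2 * v / 2))"
  shows "square_integrable M Y" "(LINT \<omega>|M. (Y \<omega>)\<^sup>2) = v"
proof -
  interpret S: real_distribution std_normal_distribution by (rule real_dist_normal_dist)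
  let ?D = "distr std_normal_distribution borel (\<lambda>x. sqrt v * x)"
  have "char ?D u = exp (- (u\<^sup>2 * v / 2))" for u
  proof -
    have "char ?D u = char std_normal_distribution (u * sqrt v)"
      by (simp only: char_def, subst integral_distr) (auto simp: mult.assoc)
    then show ?thesis using v by (simp add: char_std_normal_distribution power_mult_distrib)
  qed
  then have D: "distr M borel Y = ?D"
    by (intro Levy_uniqueness) (use char in auto)
  have mom: "integrable std_normal_distribution (\<lambda>x. (sqrt v * x)\<^sup>2)"
    "(LINT x|std_normal_distribution. (sqrt v * x)\<^sup>2) = v"
    using std_normal_distribution_even_moments[of 1] v
    by (auto simp: power_mult_distrib)
  have "integrable ?D (\<lambda>x. x\<^sup>2)"
    using mom by (subst integrable_distr_eq) auto
  then have "integrable M (\<lambda>\<omega>. (Y \<omega>)\<^sup>2)"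
    unfolding D[symmetric] by (subst (asm) integrable_distr_eq) auto
  then show "square_integrable M Y" by (simp add: square_integrable_def)
  have "(LINT \<omega>|M. (Y \<omega>)\<^sup>2) = (LINT x|distr M borel Y. x\<^sup>2)"
    by (subst integral_distr) auto
  also have "\<dots> = v"
    unfolding D using mom by (subst integral_distr) auto
  finally show "(LINT \<omega>|M. (Y \<omega>)\<^sup>2) = v" .
qed

context wiener_process
begin

lemma measurable_step_integral:
  assumes "0 \<le> a" "partition_of a b n t"
  shows "step_integral W n t y \<in> borel_measurable M"
proof -
  have [measurable]: "W (t i) \<in> borel_measurable M" if "i \<le> n" for i
    using partition_of_range(1)[OF assms(2) that] assms(1) by (intro measurable_at) auto
  show ?thesis unfolding step_integral_def
    by (intro borel_measurable_sum borel_measurable_times borel_measurable_diff) auto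
qed

text \<open>A step integral is a sum of independent centred normal variables; the variances
\<open>c\<^sup>2 (y i)\<^sup>2 (t (Suc i) - t i)\<close> add up to \<open>c\<^sup>2\<close> times the squared \<open>L\<^sup>2\<close> norm of the step function.\<close>

lemma char_step_integral:
  assumes a: "0 \<le> a" and part: "partition_of a b n t"
  shows "char (distr M borel (step_integral W n t y)) u =
    exp (- (u\<^sup>2 * (c\<^sup>2 * (LINT x|lebesgue_on {a<..<b}. (step_fun n t y x)\<^sup>2)) / 2))"
proof -
  have t: "0 \<le> t i" if "i \<le> n" for i using partition_of_range(1)[OF part that] a by simp
  have lt: "t i < t (Suc i)" if "i < n" for i using part that by (simp add: partition_of_def)
  let ?d = "\<lambda>i \<omega>. W (t (Suc i)) \<omega> - W (t i) \<omega>"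
  have "indep_vars (\<lambda>_. borel) ?d {..<n}"
    by (rule independent_increments) (use t lt in \<open>auto intro: less_imp_le\<close>)
  then have indep: "indep_vars (\<lambda>_. borel) (\<lambda>i \<omega>. y i * ?d i \<omega>) {..<n}"
    by (rule indep_vars_compose2) auto
  have one: "char (distr M borel (\<lambda>\<omega>. y i * ?d i \<omega>)) u =
      of_real (exp (- (u\<^sup>2 * (c\<^sup>2 * ((y i)\<^sup>2 * (t (Suc i) - t i))) / 2)))" if i: "i < n" for i
  proof -
    have D: "distributed M lborel (?d i) (normal_density 0 (c * sqrt (t (Suc i) - t i)))"
      using normal_increments[OF t lt] i by auto
    have [measurable]: "?d i \<in> borel_measurable M" using distributed_measurable[OF D] by simp
    have "char (distr M borel (\<lambda>\<omega>. y i * ?d i \<omega>)) u = char (distr M borel (?d i)) (u * y i)"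
      by (simp only: char_def, subst (1 2) integral_distr) (auto simp: mult.assoc)
    also have "\<dots> = exp (- ((u * y i)\<^sup>2 * (c * sqrt (t (Suc i) - t i))\<^sup>2 / 2))"
      using lt[OF i] scale_pos by (intro char_normal[OF D]) auto
    finally show ?thesis using lt[OF i] by (simp add: power_mult_distrib mult_ac)
  qed
  have "char (distr M borel (step_integral W n t y)) u =
      (\<Prod>i<n. char (distr M borel (\<lambda>\<omega>. y i * ?d i \<omega>)) u)"
    unfolding step_integral_def by (rule char_distr_sum[OF indep])
  also have "\<dots> = of_real (\<Prod>i<n. exp (- (u\<^sup>2 * (c\<^sup>2 * ((y i)\<^sup>2 * (t (Suc i) - t i))) / 2)))"
    unfolding of_real_prod using one by (intro prod.cong) auto
  also have "(\<Prod>i<n. exp (- (u\<^sup>2 * (c\<^sup>2 * ((y i)\<^sup>2 * (t (Suc i) - t i))) / 2))) =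
      exp (- (u\<^sup>2 * (c\<^sup>2 * (\<Sum>i<n. (y i)\<^sup>2 * (t (Suc i) - t i))) / 2))"
    by (simp only: exp_sum[symmetric] finite_lessThan sum_negf sum_divide_distrib sum_distrib_left)
  also have "(\<Sum>i<n. (y i)\<^sup>2 * (t (Suc i) - t i)) = (LINT x|lebesgue_on {a<..<b}. (step_fun n t y x)\<^sup>2)"
    unfolding step_fun_power2[OF part] integral_step_fun(2)[OF part] ..
  finally show ?thesis .
qed

lemma step_integral_isometry:
  assumes a: "0 \<le> a" and part: "partition_of a b n t"
  shows "square_integrable M (step_integral W n t y)"
    "(LINT \<omega>|M. (step_integral W n t y \<omega>)\<^sup>2) = c\<^sup>2 * (LINT x|lebesgue_on {a<..<b}. (step_fun n t y x)\<^sup>2)"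
  using second_moment_of_normal_char[OF measurable_step_integral[OF a part] _ char_step_integral[OF a part]]
  by auto

text \<open>Both sides of the formula for step functions are continuous with respect to convergence in \<open>L\<^sup>2\<close>.
Every version of the integral has this law, whatever approximating sequence defines it.\<close>

lemma has_wiener_integral_char:
  assumes a: "0 \<le> a" and X: "has_wiener_integral M W a b f X"
  shows "char (distr M borel X) u =
    exp (- (u\<^sup>2 * (c\<^sup>2 * (LINT x|lebesgue_on {a<..<b}. (f x)\<^sup>2)) / 2))"
proof -
  obtain n t y where part: "\<And>k. partition_of a b (n k) (t k)"
    and f: "tendsto_L2 (lebesgue_on {a<..<b}) (\<lambda>k. step_fun (n k) (t k) (y k)) f"
    and XX: "tendsto_L2 M (\<lambda>k. step_integral W (n k) (t k) (y k)) X"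
    using X unfolding has_wiener_integral_def by blast
  have "(\<lambda>k. complex_of_real (exp (- (u\<^sup>2 *
        (c\<^sup>2 * (LINT x|lebesgue_on {a<..<b}. (step_fun (n k) (t k) (y k) x)\<^sup>2)) / 2))))
      \<longlonglongrightarrow> of_real (exp (- (u\<^sup>2 * (c\<^sup>2 * (LINT x|lebesgue_on {a<..<b}. (f x)\<^sup>2)) / 2)))"
    by (intro tendsto_intros tendsto_L2_integral_square f) simp
  moreover have "(\<lambda>k. complex_of_real (exp (- (u\<^sup>2 *
        (c\<^sup>2 * (LINT x|lebesgue_on {a<..<b}. (step_fun (n k) (t k) (y k) x)\<^sup>2)) / 2))))
      \<longlonglongrightarrow> char (distr M borel X) u"
    using tendsto_L2_char[OF XX, of u] unfolding char_step_integral[OF a part] .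
  ultimately show ?thesis by (rule LIMSEQ_unique[symmetric])
qed

text \<open>The approximating step functions of different integrands live on different partitions; a common
refinement at every stage of the approximation makes their combination a step function again.\<close>

lemma has_wiener_integral_linear:
  assumes J: "finite J" and ab: "a < b"
    and X: "\<And>j. j \<in> J \<Longrightarrow> has_wiener_integral M W a b (f j) (X j)"
  shows "has_wiener_integral M W a b (\<lambda>x. \<Sum>j\<in>J. u j * f j x) (\<lambda>\<omega>. \<Sum>j\<in>J. u j * X j \<omega>)"
proof -
  define P where "P = (\<lambda>j n t y. (\<forall>k. partition_of a b (n k) (t k)) \<and>
    tendsto_L2 (lebesgue_on {a<..<b}) (\<lambda>k. step_fun (n k) (t k) (y k)) (f j) \<and>
    tendsto_L2 M (\<lambda>k. step_integral W (n k) (t k) (y k)) (X j))"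
  have "\<forall>j\<in>J. \<exists>n t y. P j n t y"
    using X unfolding has_wiener_integral_def P_def by blast
  then obtain n t y where nty: "\<forall>j\<in>J. P j (n j) (t j) (y j)"
    by metis
  have part: "\<And>j k. j \<in> J \<Longrightarrow> partition_of a b (n j k) (t j k)"
    and f: "\<And>j. j \<in> J \<Longrightarrow> tendsto_L2 (lebesgue_on {a<..<b}) (\<lambda>k. step_fun (n j k) (t j k) (y j k)) (f j)"
    and XX: "\<And>j. j \<in> J \<Longrightarrow> tendsto_L2 M (\<lambda>k. step_integral W (n j k) (t j k) (y j k)) (X j)"
    using nty unfolding P_def by blast+
  define Q where "Q = (\<lambda>k m s z. partition_of a b m s \<and>
      step_fun m s z = (\<lambda>x. \<Sum>j\<in>J. u j * step_fun (n j k) (t j k) (y j k) x) \<and>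
      step_integral W m s z = (\<lambda>\<omega>. \<Sum>j\<in>J. u j * step_integral W (n j k) (t j k) (y j k) \<omega>))"
  have "\<exists>m s z. Q k m s z" for k
  proof -
    obtain m s z where "partition_of a b m s"
      "\<And>x. step_fun m s z x = (\<Sum>j\<in>J. u j * step_fun (n j k) (t j k) (y j k) x)"
      "\<And>\<omega>. step_integral W m s z \<omega> = (\<Sum>j\<in>J. u j * step_integral W (n j k) (t j k) (y j k) \<omega>)"
      by (rule step_linear_combination[OF J ab, of "\<lambda>j. n j k" "\<lambda>j. t j k" u "\<lambda>j. y j k" W])
        (erule part, rule that)
    then have "Q k m s z" unfolding Q_def by (intro conjI ext)
    then show ?thesis by blast
  qed
  then obtain m s z where "\<forall>k. Q k (m k) (s k) (z k)" by metis
  then have msz: "\<And>k. partition_of a b (m k) (s k)"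
      "\<And>k. step_fun (m k) (s k) (z k) = (\<lambda>x. \<Sum>j\<in>J. u j * step_fun (n j k) (t j k) (y j k) x)"
      "\<And>k. step_integral W (m k) (s k) (z k) = (\<lambda>\<omega>. \<Sum>j\<in>J. u j * step_integral W (n j k) (t j k) (y j k) \<omega>)"
    unfolding Q_def by blast+
  show ?thesis unfolding has_wiener_integral_def
  proof (intro exI conjI allI)
    show "partition_of a b (m k) (s k)" for k by (rule msz)
    show "tendsto_L2 (lebesgue_on {a<..<b}) (\<lambda>k. step_fun (m k) (s k) (z k)) (\<lambda>x. \<Sum>j\<in>J. u j * f j x)"
      unfolding msz by (rule tendsto_L2_sum[OF f])
    show "tendsto_L2 M (\<lambda>k. step_integral W (m k) (s k) (z k)) (\<lambda>\<omega>. \<Sum>j\<in>J. u j * X j \<omega>)"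
      unfolding msz by (rule tendsto_L2_sum[OF XX])
  qed
qed

text \<open>A difference of two step integrals is again a step integral, so the isometry turns the Cauchy
property of the step functions into that of their integrals.\<close>

lemma has_wiener_integral_exists:
  assumes a: "0 \<le> a" and ab: "a < b" and part: "\<And>k. partition_of a b (n k) (t k)"
    and f: "tendsto_L2 (lebesgue_on {a<..<b}) (\<lambda>k. step_fun (n k) (t k) (y k)) f"
  shows "\<exists>X. has_wiener_integral M W a b f X"
proof -
  let ?L = "lebesgue_on {a<..<b}"
  let ?F = "\<lambda>k. step_fun (n k) (t k) (y k)" and ?I = "\<lambda>k. step_integral W (n k) (t k) (y k)"
  have sq: "square_integrable ?L (?F k)" "square_integrable ?L f" for k
    using f by (auto simp: tendsto_L2_def)
  have diff: "(LINT \<omega>|M. (?I i \<omega> - ?I j \<omega>)\<^sup>2) = c\<^sup>2 * (LINT x|?L. (?F i x - ?F j x)\<^sup>2)" for i j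
  proof -
    \<comment> \<open>The difference is a linear combination indexed by \<open>bool\<close>, with coefficients 1 and \<open>- 1\<close>.\<close>
    define k :: "bool \<Rightarrow> nat" where "k = (\<lambda>p. if p then i else j)"
    define u :: "bool \<Rightarrow> real" where "u = (\<lambda>p. if p then 1 else -1)"
    obtain m s z where m: "partition_of a b m s"
      and F: "\<And>x. step_fun m s z x = (\<Sum>p\<in>UNIV. u p * step_fun (n (k p)) (t (k p)) (y (k p)) x)"
      and I: "\<And>\<omega>. step_integral W m s z \<omega> = (\<Sum>p\<in>UNIV. u p * step_integral W (n (k p)) (t (k p)) (y (k p)) \<omega>)"
      by (rule step_linear_combination[OF finite[of "UNIV :: bool set"] ab,
            of "\<lambda>p. n (k p)" "\<lambda>p. t (k p)" u "\<lambda>p. y (k p)" W])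
        (rule part, rule that)
    have "step_fun m s z x = ?F i x - ?F j x" for x unfolding F UNIV_bool by (simp add: k_def u_def)
    moreover have "step_integral W m s z \<omega> = ?I i \<omega> - ?I j \<omega>" for \<omega> unfolding I UNIV_bool by (simp add: k_def u_def)
    ultimately show ?thesis using step_integral_isometry(2)[OF a m, of z] by simp
  qed
  have c2: "c\<^sup>2 > 0" using scale_pos by simp
  have "\<exists>N. \<forall>i\<ge>N. \<forall>j\<ge>N. (LINT \<omega>|M. (?I i \<omega> - ?I j \<omega>)\<^sup>2) < e" if "e > 0" for e :: real
  proof -
    have "e / (4 * c\<^sup>2) > 0" using that c2 by simp
    then have "\<forall>\<^sub>F k in sequentially. (LINT x|?L. (?F k x - f x)\<^sup>2) < e / (4 * c\<^sup>2)"
      using f unfolding tendsto_L2_def by (auto intro: order_tendstoD)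
    then obtain N where N: "\<And>k. k \<ge> N \<Longrightarrow> (LINT x|?L. (?F k x - f x)\<^sup>2) < e / (4 * c\<^sup>2)"
      unfolding eventually_sequentially by blast
    have "(LINT \<omega>|M. (?I i \<omega> - ?I j \<omega>)\<^sup>2) < e" if ij: "i \<ge> N" "j \<ge> N" for i j
    proof -
      have "(LINT x|?L. (?F i x - ?F j x)\<^sup>2) = (LINT x|?L. ((?F i x - f x) + (f x - ?F j x))\<^sup>2)" by simp
      also have "\<dots> \<le> 2 * (LINT x|?L. (?F i x - f x)\<^sup>2) + 2 * (LINT x|?L. (f x - ?F j x)\<^sup>2)"
        by (intro integral_sum_square_le square_integrable_diff sq)
      also have "(LINT x|?L. (f x - ?F j x)\<^sup>2) = (LINT x|?L. (?F j x - f x)\<^sup>2)"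
        by (simp add: power2_commute)
      finally have "(LINT x|?L. (?F i x - ?F j x)\<^sup>2) < e / c\<^sup>2"
        using N[OF ij(1)] N[OF ij(2)] by simp
      then show ?thesis unfolding diff using c2 by (simp add: field_simps)
    qed
    then show ?thesis by blast
  qed
  then obtain X where "tendsto_L2 M ?I X"
    using L2_complete[of ?I] step_integral_isometry(1)[OF a part] by blast
  then show ?thesis using f part unfolding has_wiener_integral_def by blast
qed

end

text \<open>Values at the right end points of equidistant partitions approximate \<open>f\<close> uniformly.\<close>

lemma continuous_step_approximation:
  fixes f :: "real \<Rightarrow> real"
  assumes ab: "a < b" and f: "continuous_on {a..b} f"
  obtains n t y where "\<And>k. partition_of a b (n k) (t k)"
    "tendsto_L2 (lebesgue_on {a<..<b}) (\<lambda>k. step_fun (n k) (t k) (y k)) f"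
proof -
  let ?L = "lebesgue_on {a<..<b}"
  define t where "t = (\<lambda>k i. a + (b - a) * real i / real (Suc k))"
  define y where "y = (\<lambda>k i. f (t k (Suc i)))"
  have t_Suc: "t k (Suc i) = t k i + (b - a) / real (Suc k)" for k i
    unfolding t_def of_nat_Suc[of i] by (simp only: distrib_left add_divide_distrib mult_1_right add.assoc add.commute)
  have part: "partition_of a b (Suc k) (t k)" for k
    unfolding partition_of_def
  proof (intro conjI allI impI)
    show "t k 0 = a" "t k (Suc k) = b" using ab by (simp_all add: t_def del: of_nat_Suc)
    show "t k i < t k (Suc i)" for i using ab by (simp add: t_Suc)
  qed
  have fm: "f \<in> borel_measurable ?L"
    by (rule continuous_imp_measurable_on_sets_lebesgue) (auto intro: continuous_on_subset[OF f])
  have fin: "finite_measure ?L" by (rule finite_measure_lebesgue_on) simp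
  have "bounded (f ` {a..b})"
    by (intro compact_imp_bounded compact_continuous_image f) simp
  then have "\<exists>B. \<forall>x\<in>{a..b}. \<bar>f x\<bar> \<le> B" by (simp add: bounded_iff)
  then obtain B where B: "\<And>x. x \<in> {a..b} \<Longrightarrow> \<bar>f x\<bar> \<le> B" by blast
  have "integrable ?L (\<lambda>x. (f x)\<^sup>2)"
  proof (rule finite_measure.integrable_const_bound[OF fin, of _ "B\<^sup>2"])
    show "AE x in ?L. norm ((f x)\<^sup>2) \<le> B\<^sup>2"
      using B by (intro AE_I2) (auto simp: abs_le_square_iff[symmetric] intro: order_trans[OF _ abs_ge_self])
  qed (use fm in measurable)
  then have fsq: "square_integrable ?L f" using fm by (simp add: square_integrable_def)
  have "(\<lambda>k. LINT x|?L. (step_fun (Suc k) (t k) (y k) x - f x)\<^sup>2) \<longlonglongrightarrow> 0"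
  proof (rule LIMSEQ_I)
    fix e :: real assume "e > 0"
    \<comment> \<open>An error of \<open>d\<close> in the supremum norm costs at most \<open>d\<^sup>2 (b - a)\<close> in the squared \<open>L\<^sup>2\<close> norm.\<close>
    define d where "d = sqrt (e / 2 / (b - a))"
    have "d\<^sup>2 = e / 2 / (b - a)" using \<open>e > 0\<close> ab by (simp only: d_def) simp
    then have d2: "d\<^sup>2 * (b - a) = e / 2"
      using ab nonzero_eq_divide_eq[of "b - a" "d\<^sup>2" "e / 2"] by linarith
    have d: "d > 0" using \<open>e > 0\<close> ab by (simp add: d_def)
    have "uniformly_continuous_on {a..b} f"
      by (intro compact_uniformly_continuous f) simp
    then obtain \<delta> where \<delta>: "\<delta> > 0"
        "\<And>x x'. x \<in> {a..b} \<Longrightarrow> x' \<in> {a..b} \<Longrightarrow> \<bar>x' - x\<bar> < \<delta> \<Longrightarrow> \<bar>f x' - f x\<bar> < d"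
      unfolding uniformly_continuous_on_def dist_real_def using d by metis
    obtain N where N: "(b - a) / \<delta> < real N" using reals_Archimedean2 by blast
    have "norm ((LINT x|?L. (step_fun (Suc k) (t k) (y k) x - f x)\<^sup>2) - 0) < e" if k: "k \<ge> N" for k
    proof -
      have near: "\<bar>step_fun (Suc k) (t k) (y k) x - f x\<bar> \<le> d" if x: "a < x" "x < b" for x
      proof -
        obtain i where i: "i < Suc k" "x \<in> {t k i<..t k (Suc i)}"
          using partition_of_cell[OF part x(1), of k] x by auto
        have "t k (Suc i) - t k i = (b - a) / real (Suc k)"
          unfolding t_Suc by simp
        also have "\<dots> < \<delta>"
        proof -
          have "(b - a) / \<delta> < real (Suc k)" using N k by simp
          then show ?thesis using \<delta>(1) by (simp add: field_simps del: of_nat_Suc)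
        qed
        finally have "\<bar>t k (Suc i) - x\<bar> < \<delta>" using i by auto
        moreover have "t k (Suc i) \<in> {a..b}" using partition_of_range[OF part] i by auto
        ultimately have "\<bar>f (t k (Suc i)) - f x\<bar> < d" using \<delta>(2) x by simp
        then show ?thesis using step_fun_eq[OF part i] by (simp add: y_def)
      qed
      have "(LINT x|?L. (step_fun (Suc k) (t k) (y k) x - f x)\<^sup>2) \<le> (LINT x|?L. d\<^sup>2)"
      proof (rule integral_mono)
        show "integrable ?L (\<lambda>x. (step_fun (Suc k) (t k) (y k) x - f x)\<^sup>2)"
          using square_integrable_diff[OF square_integrable_step_fun[OF part] fsq]
          by (simp add: square_integrable_def)
        show "integrable ?L (\<lambda>x. d\<^sup>2)" by (rule finite_measure.integrable_const[OF fin])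
        show "(step_fun (Suc k) (t k) (y k) x - f x)\<^sup>2 \<le> d\<^sup>2" if "x \<in> space ?L" for x
          using near[of x] that d by (auto simp: abs_le_square_iff[symmetric])
      qed
      also have "\<dots> = d\<^sup>2 * (b - a)" using ab by (simp add: measure_restrict_space)
      finally show ?thesis using d2 \<open>e > 0\<close> by simp
    qed
    then show "\<exists>N. \<forall>k\<ge>N. norm ((LINT x|?L. (step_fun (Suc k) (t k) (y k) x - f x)\<^sup>2) - 0) < e" by blast
  qed
  then have "tendsto_L2 ?L (\<lambda>k. step_fun (Suc k) (t k) (y k)) f"
    using fsq square_integrable_step_fun[OF part] unfolding tendsto_L2_def by blast
  with part show ?thesis by (rule that)
qed

text \<open>The choice operator in the definition of the integral picks a genuine version as soon as one exists.\<close>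

lemma (in wiener_process) wiener_integral_continuous:
  assumes "0 \<le> a" "a < b" "continuous_on {a..b} f"
  shows "has_wiener_integral M W a b f (wiener_integral M W a b f)"
proof -
  obtain n t y where "\<And>k. partition_of a b (n k) (t k)"
    "tendsto_L2 (lebesgue_on {a<..<b}) (\<lambda>k. step_fun (n k) (t k) (y k)) f"
    using continuous_step_approximation[OF assms(2,3)] by metis
  then have "\<exists>X. has_wiener_integral M W a b f X"
    using has_wiener_integral_exists[OF assms(1,2)] by blast
  then show ?thesis unfolding wiener_integral_def by (rule someI_ex)
qed

text \<open>A linear combination of the integrals is the integral of the linear combination of the integrands,
so its characteristic function is determined by an \<open>L\<^sup>2\<close> norm. For orthogonal integrands the square of
this norm is additive, and the joint characteristic function becomes a product.\<close>

theorem (in wiener_process) indep_vars_wiener_integrals_of_orthogonal: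
  assumes ab: "0 \<le> a" "a < b"
    and X: "\<And>i. i \<in> I \<Longrightarrow> has_wiener_integral M W a b (f i) (X i)"
    and orth: "\<And>i j. i \<in> I \<Longrightarrow> j \<in> I \<Longrightarrow> i \<noteq> j \<Longrightarrow> (LINT x|lebesgue_on {a<..<b}. f i x * f j x) = 0"
  shows "indep_vars (\<lambda>_. borel) X I"
proof (rule indep_vars_if_char_factors)
  fix i assume "i \<in> I"
  then show "random_variable borel (X i)"
    using X[of i] unfolding has_wiener_integral_def tendsto_L2_def square_integrable_def by blast
next
  fix J u assume J: "finite J" "J \<subseteq> I"
  let ?L = "lebesgue_on {a<..<b}"
  have sq: "square_integrable ?L (f j)" if "j \<in> J" for j
    using X[of j] that J unfolding has_wiener_integral_def tendsto_L2_def by blast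
  have int: "integrable ?L (\<lambda>x. f i x * f j x)" if "i \<in> J" "j \<in> J" for i j
    using sq that by (intro square_integrable_mult_integrable)
  have "(LINT x|?L. (\<Sum>j\<in>J. u j * f j x)\<^sup>2) = (LINT x|?L. (\<Sum>i\<in>J. \<Sum>j\<in>J. u i * u j * (f i x * f j x)))"
    by (simp add: power2_eq_square sum_product mult_ac)
  also have "\<dots> = (\<Sum>i\<in>J. \<Sum>j\<in>J. u i * u j * (LINT x|?L. f i x * f j x))"
    using int by (simp add: Bochner_Integration.integral_sum)
  also have "\<dots> = (\<Sum>i\<in>J. \<Sum>j\<in>J. if i = j then (u i)\<^sup>2 * (LINT x|?L. (f i x)\<^sup>2) else 0)"
    using orth J by (intro sum.cong refl) (auto simp: power2_eq_square)
  also have "\<dots> = (\<Sum>i\<in>J. (u i)\<^sup>2 * (LINT x|?L. (f i x)\<^sup>2))"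
    using J by simp
  finally have norm: "(LINT x|?L. (\<Sum>j\<in>J. u j * f j x)\<^sup>2) = (\<Sum>i\<in>J. (u i)\<^sup>2 * (LINT x|?L. (f i x)\<^sup>2))" .
  have "has_wiener_integral M W a b (\<lambda>x. \<Sum>j\<in>J. u j * f j x) (\<lambda>\<omega>. \<Sum>j\<in>J. u j * X j \<omega>)"
    using J X by (intro has_wiener_integral_linear ab) auto
  from has_wiener_integral_char[OF ab(1) this, of 1]
  have "char (distr M borel (\<lambda>\<omega>. \<Sum>j\<in>J. u j * X j \<omega>)) 1 =
      of_real (exp (\<Sum>j\<in>J. - ((u j)\<^sup>2 * (c\<^sup>2 * (LINT x|?L. (f j x)\<^sup>2)) / 2)))"
    unfolding norm by (simp add: sum_distrib_left sum_negf sum_divide_distrib mult_ac)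
  also have "\<dots> = (\<Prod>j\<in>J. of_real (exp (- ((u j)\<^sup>2 * (c\<^sup>2 * (LINT x|?L. (f j x)\<^sup>2)) / 2))))"
    using J(1) by (simp only: exp_sum of_real_prod)
  also have "\<dots> = (\<Prod>j\<in>J. char (distr M borel (X j)) (u j))"
    using J X by (intro prod.cong refl has_wiener_integral_char[OF ab(1), symmetric]) auto
  finally show "char (distr M borel (\<lambda>\<omega>. \<Sum>j\<in>J. u j * X j \<omega>)) 1 = (\<Prod>j\<in>J. char (distr M borel (X j)) (u j))" .
qed

section \<open>Transformed Hermite functions\<close>

text \<open>The polynomial factor of the \<open>n\<close>-th derivative of \<open>exp (- u\<^sup>2)\<close>, that is \<open>(- 1)\<^sup>n\<close> times the \<open>n\<close>-th Hermite
polynomial.\<close>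

primrec gauss_deriv_poly :: "nat \<Rightarrow> real poly" where
  "gauss_deriv_poly 0 = 1"
| "gauss_deriv_poly (Suc n) = pderiv (gauss_deriv_poly n) - [:0, 2:] * gauss_deriv_poly n"

lemma DERIV_poly_gauss:
  "((\<lambda>u. poly p u * exp (- (u\<^sup>2))) has_real_derivative
    poly (pderiv p - [:0, 2:] * p) u * exp (- (u\<^sup>2))) (at u)"
  by (auto intro!: derivative_eq_intros poly_DERIV simp: algebra_simps)

lemma deriv_iter_gauss:
  "(deriv ^^ n) (\<lambda>u::real. exp (- (u\<^sup>2))) = (\<lambda>u. poly (gauss_deriv_poly n) u * exp (- (u\<^sup>2)))"
proof (induction n)
  case (Suc n)
  show ?case
    using DERIV_imp_deriv[OF DERIV_poly_gauss, of "gauss_deriv_poly n"]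
    by (simp add: Suc fun_eq_iff)
qed simp

lemma hermite_eq_poly: "hermite n t = (- 1) ^ n * poly (gauss_deriv_poly n) t"
  unfolding hermite_def deriv_iter_gauss by (simp flip: exp_add)

lemma degree_gauss_deriv_poly: "degree (gauss_deriv_poly n) \<le> n"
proof (induction n)
  case (Suc n)
  have "degree ([:0, 2:] * gauss_deriv_poly n) \<le> Suc n"
    using degree_mult_le[of "[:0, 2:]" "gauss_deriv_poly n"] Suc by simp
  moreover have "degree (pderiv (gauss_deriv_poly n)) \<le> Suc n"
    using Suc by (simp add: degree_pderiv)
  ultimately show ?case by (simp add: degree_diff_le)
qed simp

text \<open>The arbitrary rate \<open>d\<close> makes the induction on the polynomial work: a further factor \<open>u\<close> is at most
\<open>exp \<bar>u\<bar>\<close> and is paid for by raising the rate by one.\<close>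

lemma poly_gauss_decay:
  fixes p :: "real poly" and d :: real
  shows "\<exists>K. \<forall>u. \<bar>poly p u * exp (- (u\<^sup>2))\<bar> \<le> K * exp (- (d * \<bar>u\<bar>))"
proof (induction p arbitrary: d)
  case 0
  show ?case by (intro exI[of _ 0]) simp
next
  case (pCons a p)
  obtain K where K: "\<And>u. \<bar>poly p u * exp (- (u\<^sup>2))\<bar> \<le> K * exp (- ((d + 1) * \<bar>u\<bar>))"
    using pCons.IH[of "d + 1"] by blast
  have "\<bar>poly (pCons a p) u * exp (- (u\<^sup>2))\<bar> \<le> (\<bar>a\<bar> * exp (d\<^sup>2 / 4) + K) * exp (- (d * \<bar>u\<bar>))" for u
  proof -
    \<comment> \<open>Completing the square.\<close>
    have "d * \<bar>u\<bar> - u\<^sup>2 \<le> d\<^sup>2 / 4"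
      using zero_le_power2[of "\<bar>u\<bar> - d / 2"] by (simp add: power2_diff power_divide field_simps)
    then have "exp (- (u\<^sup>2)) \<le> exp (d\<^sup>2 / 4 + - (d * \<bar>u\<bar>))" by simp
    then have 1: "\<bar>a\<bar> * exp (- (u\<^sup>2)) \<le> \<bar>a\<bar> * (exp (d\<^sup>2 / 4) * exp (- (d * \<bar>u\<bar>)))"
      by (intro mult_left_mono) (simp_all only: exp_add abs_ge_zero)
    have "\<bar>u\<bar> \<le> exp \<bar>u\<bar>" using exp_ge_add_one_self[of "\<bar>u\<bar>"] by linarith
    then have "\<bar>u\<bar> * \<bar>poly p u * exp (- (u\<^sup>2))\<bar> \<le> exp \<bar>u\<bar> * (K * exp (- ((d + 1) * \<bar>u\<bar>)))"
      using K[of u] by (intro mult_mono) auto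
    also have "\<dots> = K * exp (- (d * \<bar>u\<bar>))"
      by (simp add: algebra_simps flip: exp_add)
    finally have 2: "\<bar>u\<bar> * \<bar>poly p u * exp (- (u\<^sup>2))\<bar> \<le> K * exp (- (d * \<bar>u\<bar>))" .
    have "\<bar>poly (pCons a p) u * exp (- (u\<^sup>2))\<bar> = \<bar>a * exp (- (u\<^sup>2)) + u * (poly p u * exp (- (u\<^sup>2)))\<bar>"
      by (simp add: algebra_simps)
    also have "\<dots> \<le> \<bar>a\<bar> * exp (- (u\<^sup>2)) + \<bar>u\<bar> * \<bar>poly p u * exp (- (u\<^sup>2))\<bar>"
      by (intro order_trans[OF abs_triangle_ineq]) (simp add: abs_mult)
    finally show ?thesis using 1 2 by (simp add: algebra_simps)
  qed
  then show ?case by blast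
qed

lemma poly_gauss_scaled_decay:
  fixes p :: "real poly"
  assumes \<alpha>: "\<alpha> > 0" and q: "q > 0"
  obtains K where "K \<ge> 0" "\<And>u. \<bar>poly p (\<alpha> * u) * exp (- (q * (\<alpha> * u)\<^sup>2))\<bar> \<le> K * exp (- (d * \<bar>u\<bar>))"
proof -
  \<comment> \<open>Rescaling the argument by \<open>sqrt q\<close> turns \<open>exp (- q v\<^sup>2)\<close> into \<open>exp (- u\<^sup>2)\<close>.\<close>
  define r where "r = pcompose p [:0, 1 / sqrt q:]"
  have r: "poly r (sqrt q * v) = poly p v" for v
    unfolding r_def using q by (simp add: poly_pcompose)
  obtain K where K: "\<And>u. \<bar>poly r u * exp (- (u\<^sup>2))\<bar> \<le> K * exp (- (d / (\<alpha> * sqrt q) * \<bar>u\<bar>))"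
    using poly_gauss_decay[of r] by blast
  have "K \<ge> 0" using order_trans[OF abs_ge_zero K[of 0]] by simp
  moreover have "\<bar>poly p (\<alpha> * u) * exp (- (q * (\<alpha> * u)\<^sup>2))\<bar> \<le> K * exp (- (d * \<bar>u\<bar>))" for u
  proof -
    have "(sqrt q * (\<alpha> * u))\<^sup>2 = q * (\<alpha> * u)\<^sup>2" using q by (simp add: power_mult_distrib)
    moreover have "d / (\<alpha> * sqrt q) * \<bar>sqrt q * (\<alpha> * u)\<bar> = d * \<bar>u\<bar>"
      using \<alpha> q by (simp add: abs_mult)
    ultimately show ?thesis using K[of "sqrt q * (\<alpha> * u)"] by (simp only: r)
  qed
  ultimately show ?thesis by (rule that)
qed

lemma exp_logit:
  assumes "0 < x" "x < 1"
  shows "exp (logit x) = x / (1 - x)"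
  using assms by (simp add: logit_def)

lemma DERIV_logit:
  assumes "0 < x" "x < 1"
  shows "(logit has_real_derivative logit_weight x) (at x)"
  unfolding logit_def[abs_def] logit_weight_def using assms
  by (auto intro!: derivative_eq_intros simp: divide_simps)

lemma exp_abs_logit:
  assumes x: "0 < x" "x < 1"
  shows "exp (- \<bar>logit x\<bar>) = min (x / (1 - x)) ((1 - x) / x)"
proof -
  have e: "exp (- \<bar>t\<bar>) = min (exp t) (exp (- t))" for t :: real by (auto simp: min_def abs_if)
  show ?thesis by (subst e) (simp add: exp_minus exp_logit[OF x])
qed


text \<open>Exponential decay in \<open>logit x\<close> means decay at the rate of \<open>x (1 - x)\<close>, the reciprocal of the weight,
at both end points.\<close>

lemma exp_neg_abs_logit_le:
  assumes x: "0 < x" "x < 1"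
  shows "exp (- \<bar>logit x\<bar>) \<le> 4 * (x * (1 - x))"
proof -
  have half: "y / (1 - y) \<le> 4 * (y * (1 - y))" if "0 < y" "y \<le> 1 / 2" for y :: real
  proof -
    have "1 / 4 \<le> (1 - y)\<^sup>2"
      using power_mono[of "1 / 2" "1 - y" 2] that by (simp add: power2_eq_square)
    then have "y * 1 \<le> y * (4 * (1 - y)\<^sup>2)" using that by (intro mult_left_mono) auto
    then show ?thesis using that by (simp add: divide_le_eq power2_eq_square mult_ac)
  qed
  show ?thesis
  proof (cases "x \<le> 1 / 2")
    case True
    then show ?thesis using half[of x] x unfolding exp_abs_logit[OF x] by linarith
  next
    case False
    then have "(1 - x) / x \<le> 4 * (x * (1 - x))" using half[of "1 - x"] x by (simp add: mult_ac)
    then show ?thesis unfolding exp_abs_logit[OF x] by linarith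
  qed
qed

lemma exp_neg_twice_abs_logit_le:
  assumes x: "0 < x" "x < 1"
  shows "exp (- (2 * \<bar>logit x\<bar>)) \<le> 16 * (x * (1 - x))\<^sup>2"
proof -
  have "exp (- (2 * \<bar>logit x\<bar>)) = (exp (- \<bar>logit x\<bar>))\<^sup>2" by (simp flip: exp_double)
  also have "\<dots> \<le> (4 * (x * (1 - x)))\<^sup>2"
    by (intro power_mono exp_neg_abs_logit_le x) simp
  finally show ?thesis by (simp add: power_mult_distrib)
qed

lemma continuous_on_unit_interval:
  fixes g :: "real \<Rightarrow> real"
  assumes cont: "continuous_on {0<..<1} g" and ends: "g 0 = 0" "g 1 = 0"
    and bound: "\<And>x. 0 < x \<Longrightarrow> x < 1 \<Longrightarrow> \<bar>g x\<bar> \<le> K * (x * (1 - x))"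
  shows "continuous_on {0..1} g"
  unfolding continuous_on_eq_continuous_within
proof
  fix x :: real assume x: "x \<in> {0..1}"
  show "continuous (at x within {0..1}) g"
  proof (cases "x = 0 \<or> x = 1")
    case False
    then have "x \<in> {0<..<1}" using x by auto
    then have "isCont g x" using cont by (simp add: continuous_on_eq_continuous_at)
    then show ?thesis by (rule continuous_at_imp_continuous_at_within)
  next
    case True
    have "((\<lambda>y. K * (y * (1 - y))) \<longlongrightarrow> K * (x * (1 - x))) (at x within {0..1})"
      by (intro tendsto_intros)
    then have lim: "((\<lambda>y. K * (y * (1 - y))) \<longlongrightarrow> 0) (at x within {0..1})" using True by auto
    have "\<forall>\<^sub>F y in at x within {0..1}. norm (g y) \<le> K * (y * (1 - y))"
      unfolding eventually_at_filter
    proof (intro always_eventually allI impI)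
      fix y :: real assume "y \<in> {0..1}"
      then show "norm (g y) \<le> K * (y * (1 - y))"
        using bound[of y] ends by (cases "y = 0 \<or> y = 1") auto
    qed
    then have "(g \<longlongrightarrow> 0) (at x within {0..1})" by (rule Lim_null_comparison[OF _ lim])
    then show ?thesis unfolding continuous_within using True ends by auto
  qed
qed

lemma continuous_on_logit: "continuous_on {0<..<1} logit"
  unfolding logit_def by (intro continuous_intros) auto

text \<open>The function \<open>r (u) exp (- u\<^sup>2)\<close> transported to the unit interval by \<open>u = \<alpha> logit x\<close>. Up to constants,
products of two transformed Hermite functions have this form.\<close>

definition gauss_logit :: "real \<Rightarrow> real poly \<Rightarrow> real \<Rightarrow> real" where
  "gauss_logit \<alpha> r x = poly r (\<alpha> * logit x) * exp (- ((\<alpha> * logit x)\<^sup>2))"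

lemma continuous_on_gauss_logit: "continuous_on {0<..<1} (gauss_logit \<alpha> r)"
  unfolding gauss_logit_def by (intro continuous_intros continuous_on_logit continuous_on_poly)

lemma gauss_logit_bound:
  assumes "\<alpha> > 0"
  obtains K where "K \<ge> 0" "\<And>x. 0 < x \<Longrightarrow> x < 1 \<Longrightarrow> \<bar>gauss_logit \<alpha> r x\<bar> \<le> K * (x * (1 - x))\<^sup>2"
proof -
  obtain K where K: "K \<ge> 0"
    "\<And>u. \<bar>poly r (\<alpha> * u) * exp (- (1 * (\<alpha> * u)\<^sup>2))\<bar> \<le> K * exp (- (2 * \<bar>u\<bar>))"
    using poly_gauss_scaled_decay[OF assms zero_less_one] by metis
  have "\<bar>gauss_logit \<alpha> r x\<bar> \<le> (K * 16) * (x * (1 - x))\<^sup>2" if x: "0 < x" "x < 1" for x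
  proof -
    have "exp (- (2 * \<bar>logit x\<bar>)) \<le> 16 * (x * (1 - x))\<^sup>2"
      by (rule exp_neg_twice_abs_logit_le[OF x])
    then have "K * exp (- (2 * \<bar>logit x\<bar>)) \<le> K * (16 * (x * (1 - x))\<^sup>2)"
      using K(1) by (rule mult_left_mono)
    then show ?thesis using K(2)[of "logit x"] unfolding gauss_logit_def by simp
  qed
  then show ?thesis using K(1) by (intro that[of "K * 16"]) auto
qed

lemma integrable_gauss_logit:
  assumes "\<alpha> > 0"
  shows "integrable (lebesgue_on {0<..<1}) (\<lambda>x. gauss_logit \<alpha> r x * logit_weight x)"
proof -
  obtain K where K: "K \<ge> 0" "\<And>x. 0 < x \<Longrightarrow> x < 1 \<Longrightarrow> \<bar>gauss_logit \<alpha> r x\<bar> \<le> K * (x * (1 - x))\<^sup>2"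
    using gauss_logit_bound[OF assms] by metis
  show ?thesis
  proof (rule finite_measure.integrable_const_bound[of _ _ K])
    show "finite_measure (lebesgue_on {0<..<1::real})" by (rule finite_measure_lebesgue_on) simp
    show "(\<lambda>x. gauss_logit \<alpha> r x * logit_weight x) \<in> borel_measurable (lebesgue_on {0<..<1})"
      unfolding logit_weight_def
      by (intro continuous_imp_measurable_on_sets_lebesgue continuous_intros continuous_on_gauss_logit) auto
    have "\<bar>gauss_logit \<alpha> r x * logit_weight x\<bar> \<le> K" if x: "0 < x" "x < 1" for x
    proof -
      have p: "0 < x * (1 - x)" using x by simp
      have "x * (1 - x) \<le> 1 * 1" using x by (intro mult_mono) auto
      have "\<bar>gauss_logit \<alpha> r x * logit_weight x\<bar> = \<bar>gauss_logit \<alpha> r x\<bar> / (x * (1 - x))"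
        using p x by (simp add: logit_weight_def abs_mult)
      also have "\<dots> \<le> K * (x * (1 - x))\<^sup>2 / (x * (1 - x))"
        using p by (intro divide_right_mono K x) simp
      also have "\<dots> = K * (x * (1 - x))" using p x by (simp add: power2_eq_square)
      also have "\<dots> \<le> K * 1" using K(1) \<open>x * (1 - x) \<le> 1 * 1\<close> by (intro mult_left_mono) auto
      finally show ?thesis by simp
    qed
    then show "AE x in lebesgue_on {0<..<1}. norm (gauss_logit \<alpha> r x * logit_weight x) \<le> K"
      by (intro AE_I2) auto
  qed
qed

text \<open>Up to the factor \<open>\<alpha>\<close> the integrand is the derivative of \<open>gauss_logit \<alpha> r\<close>, because the weight is the
derivative of \<open>logit\<close>. The fundamental theorem of calculus can thus be applied on the unit interval
itself, where the boundary values are 0.\<close>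

lemma integral_gauss_logit_derivative:
  assumes \<alpha>: "\<alpha> > 0"
  shows "(LINT x|lebesgue_on {0<..<1}. gauss_logit \<alpha> (pderiv r - [:0, 2:] * r) x * logit_weight x) = 0"
proof -
  let ?r' = "pderiv r - [:0, 2:] * r"
  \<comment> \<open>Since \<open>logit\<close> takes the value 0 at 0 and 1, the boundary limits have to be inserted by hand.\<close>
  let ?F = "\<lambda>x. if x = 0 \<or> x = 1 then 0 else gauss_logit \<alpha> r x"
  let ?f = "\<lambda>x. \<alpha> * (gauss_logit \<alpha> ?r' x * logit_weight x)"
  obtain K where K: "K \<ge> 0" "\<And>x. 0 < x \<Longrightarrow> x < 1 \<Longrightarrow> \<bar>gauss_logit \<alpha> r x\<bar> \<le> K * (x * (1 - x))\<^sup>2"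
    using gauss_logit_bound[OF \<alpha>] by metis
  have cont: "continuous_on {0..1} ?F"
  proof (rule continuous_on_unit_interval[of _ K])
    show "continuous_on {0<..<1} ?F"
      by (rule continuous_on_eq[OF continuous_on_gauss_logit[of \<alpha> r]]) auto
    fix x :: real assume x: "0 < x" "x < 1"
    have "(x * (1 - x)) * (x * (1 - x)) \<le> 1 * (x * (1 - x))"
      using x by (intro mult_right_mono mult_le_one) auto
    then have "K * (x * (1 - x))\<^sup>2 \<le> K * (x * (1 - x))"
      using K(1) by (intro mult_left_mono) (auto simp: power2_eq_square)
    then show "\<bar>?F x\<bar> \<le> K * (x * (1 - x))" using K(2)[OF x] x by simp
  qed auto
  have deriv: "(?F has_vector_derivative ?f x) (at x)" if x: "x \<in> {0<..<1}" for x
  proof -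
    have "((\<lambda>y. \<alpha> * logit y) has_real_derivative \<alpha> * logit_weight x) (at x)"
      using DERIV_cmult[OF DERIV_logit] x by simp
    from DERIV_chain2[OF DERIV_poly_gauss[of r] this]
    have "(gauss_logit \<alpha> r has_real_derivative ?f x) (at x)"
      unfolding gauss_logit_def[abs_def] by (simp add: mult_ac)
    then have "(?F has_real_derivative ?f x) (at x)"
      by (rule has_field_derivative_transform_within_open[of _ _ _ "{0<..<1}"]) (use x in auto)
    then show ?thesis by (rule has_real_derivative_iff_has_vector_derivative[THEN iffD1])
  qed
  have "(?f has_integral (?F 1 - ?F 0)) {0..1}"
    by (rule fundamental_theorem_of_calculus_interior[OF _ cont deriv]) auto
  then have "(?f has_integral 0) {0<..<1}"
    by (simp add: has_integral_Icc_iff_Ioo)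
  moreover have "(?f has_integral (LINT x|lebesgue_on {0<..<1}. ?f x)) {0<..<1}"
    using integrable_gauss_logit[OF \<alpha>, of ?r'] by (intro has_integral_integral_lebesgue_on) auto
  ultimately have "(LINT x|lebesgue_on {0<..<1}. ?f x) = 0" by (rule has_integral_unique[rotated])
  then show ?thesis using \<alpha> by simp
qed

text \<open>Integration by parts moves a derivative from the Gaussian to \<open>q\<close>, up to sign, until \<open>q\<close> has been
differentiated away.\<close>

lemma gauss_deriv_poly_orthogonal_lower_degree:
  assumes \<alpha>: "\<alpha> > 0"
  shows "q = 0 \<or> degree q < n \<Longrightarrow>
    (LINT x|lebesgue_on {0<..<1}. gauss_logit \<alpha> (gauss_deriv_poly n * q) x * logit_weight x) = 0"
proof (induction n arbitrary: q)
  case 0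
  then show ?case by (simp add: gauss_logit_def)
next
  case (Suc n)
  let ?I = "\<lambda>r. LINT x|lebesgue_on {0<..<1}. gauss_logit \<alpha> r x * logit_weight x"
  have "pderiv q = 0 \<or> degree (pderiv q) < n"
    using Suc.prems by (cases "degree q = 0") (auto simp: degree_pderiv pderiv_eq_0_iff)
  then have IH: "?I (gauss_deriv_poly n * pderiv q) = 0" by (rule Suc.IH)
  have split: "pderiv (gauss_deriv_poly n * q) - [:0, 2:] * (gauss_deriv_poly n * q) =
      gauss_deriv_poly (Suc n) * q + gauss_deriv_poly n * pderiv q"
    by (simp add: pderiv_mult algebra_simps)
  have "?I (gauss_deriv_poly (Suc n) * q + gauss_deriv_poly n * pderiv q) =
      (LINT x|lebesgue_on {0<..<1}. gauss_logit \<alpha> (gauss_deriv_poly (Suc n) * q) x * logit_weight x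
        + gauss_logit \<alpha> (gauss_deriv_poly n * pderiv q) x * logit_weight x)"
    by (simp only: gauss_logit_def poly_add distrib_right)
  also have "\<dots> = ?I (gauss_deriv_poly (Suc n) * q) + ?I (gauss_deriv_poly n * pderiv q)"
    by (intro Bochner_Integration.integral_add integrable_gauss_logit \<alpha>)
  finally show ?case
    using integral_gauss_logit_derivative[OF \<alpha>, of "gauss_deriv_poly n * q"] IH unfolding split by simp
qed

lemma weighted_hermite_orthogonal:
  assumes \<alpha>: "\<alpha> > 0" and "n \<noteq> m"
  shows "(LINT x|lebesgue_on {0<..<1}.
    (transformed_hermite \<alpha> n x * sqrt (logit_weight x)) * (transformed_hermite \<alpha> m x * sqrt (logit_weight x))) = 0"
proof -
  define C where "C = (\<lambda>n. sqrt \<alpha> / sqrt (2 ^ n * fact n * sqrt pi) * (- 1) ^ n)"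
  let ?I = "\<lambda>r. LINT x|lebesgue_on {0<..<1}. gauss_logit \<alpha> r x * logit_weight x"
  have eq: "(transformed_hermite \<alpha> n x * sqrt (logit_weight x)) * (transformed_hermite \<alpha> m x * sqrt (logit_weight x))
      = C n * C m * (gauss_logit \<alpha> (gauss_deriv_poly n * gauss_deriv_poly m) x * logit_weight x)"
    if x: "x \<in> {0<..<1}" for x
  proof -
    have w: "sqrt (logit_weight x) * sqrt (logit_weight x) = logit_weight x"
      using x by (simp add: logit_weight_def)
    have e: "exp (- (\<alpha>\<^sup>2 * (logit x)\<^sup>2 / 2)) * exp (- (\<alpha>\<^sup>2 * (logit x)\<^sup>2 / 2)) = exp (- ((\<alpha> * logit x)\<^sup>2))"
      by (simp add: power_mult_distrib flip: exp_add)
    have "(transformed_hermite \<alpha> n x * sqrt (logit_weight x)) * (transformed_hermite \<alpha> m x * sqrt (logit_weight x)) =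
        C n * C m * (poly (gauss_deriv_poly n) (\<alpha> * logit x) * poly (gauss_deriv_poly m) (\<alpha> * logit x) *
          (exp (- (\<alpha>\<^sup>2 * (logit x)\<^sup>2 / 2)) * exp (- (\<alpha>\<^sup>2 * (logit x)\<^sup>2 / 2))) *
          (sqrt (logit_weight x) * sqrt (logit_weight x)))"
      unfolding transformed_hermite_def hermite_fun_def hermite_eq_poly C_def by (simp only: mult_ac)
    then show ?thesis
      unfolding w e gauss_logit_def poly_mult by (simp only: mult.assoc)
  qed
  have zero: "?I (gauss_deriv_poly n * gauss_deriv_poly m) = 0" if "m < n" for n m
    using gauss_deriv_poly_orthogonal_lower_degree[OF \<alpha>, of "gauss_deriv_poly m" n]
      degree_gauss_deriv_poly[of m] that by auto
  have "?I (gauss_deriv_poly n * gauss_deriv_poly m) = 0"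
    using zero[of n m] zero[of m n] \<open>n \<noteq> m\<close> by (cases n m rule: linorder_cases) (auto simp: mult.commute)
  then show ?thesis
    using eq by (subst Bochner_Integration.integral_cong[OF refl eq]) auto
qed

text \<open>At the end points \<open>logit_weight\<close> has the value \<open>1 / 0 = 0\<close>, and the limits there are 0
as well: the Gaussian decay beats the growth of the square root of the weight.\<close>

lemma continuous_weighted_hermite:
  assumes \<alpha>: "\<alpha> > 0"
  shows "continuous_on {0..1} (\<lambda>x. transformed_hermite \<alpha> n x * sqrt (logit_weight x))"
proof -
  define C where "C = sqrt \<alpha> / sqrt (2 ^ n * fact n * sqrt pi) * (- 1) ^ n"
  have eq: "transformed_hermite \<alpha> n x =
      C * (poly (gauss_deriv_poly n) (\<alpha> * logit x) * exp (- (1 / 2 * (\<alpha> * logit x)\<^sup>2)))" for x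
    unfolding transformed_hermite_def hermite_fun_def hermite_eq_poly C_def
    by (simp add: power_mult_distrib)
  obtain K where K: "K \<ge> 0" "\<And>u. \<bar>poly (gauss_deriv_poly n) (\<alpha> * u) * exp (- (1 / 2 * (\<alpha> * u)\<^sup>2))\<bar>
      \<le> K * exp (- (2 * \<bar>u\<bar>))"
    using poly_gauss_scaled_decay[OF \<alpha>, of "1 / 2" "gauss_deriv_poly n" 2] by auto
  show ?thesis
  proof (rule continuous_on_unit_interval)
    show "continuous_on {0<..<1} (\<lambda>x. transformed_hermite \<alpha> n x * sqrt (logit_weight x))"
      unfolding eq logit_weight_def
      by (intro continuous_intros continuous_on_logit) auto
    fix x :: real assume x: "0 < x" "x < 1"
    have p: "0 < x * (1 - x)" using x by simp
    have p1: "x * (1 - x) \<le> 1" using mult_mono[of x 1 "1 - x" 1] x by simp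
    have w: "0 \<le> logit_weight x" "logit_weight x * (x * (1 - x)) = 1"
      using x by (auto simp: logit_weight_def)
    have "1 \<le> logit_weight x" using p p1 by (simp add: logit_weight_def)
    then have "sqrt (logit_weight x) \<le> logit_weight x"
      by (intro real_le_lsqrt) (auto simp: self_le_power)
    have e: "exp (- (2 * \<bar>logit x\<bar>)) \<le> 16 * (x * (1 - x))\<^sup>2"
      by (rule exp_neg_twice_abs_logit_le[OF x])
    have "\<bar>transformed_hermite \<alpha> n x * sqrt (logit_weight x)\<bar> =
        \<bar>C\<bar> * \<bar>poly (gauss_deriv_poly n) (\<alpha> * logit x) * exp (- (1 / 2 * (\<alpha> * logit x)\<^sup>2))\<bar> * sqrt (logit_weight x)"
      unfolding eq using w by (simp add: abs_mult)
    also have "\<dots> \<le> \<bar>C\<bar> * (K * (16 * (x * (1 - x))\<^sup>2)) * logit_weight x"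
      using K(1) e order_trans[OF K(2)[of "logit x"] mult_left_mono[OF e K(1)]] \<open>sqrt (logit_weight x) \<le> logit_weight x\<close> w
      by (intro mult_mono mult_nonneg_nonneg) auto
    also have "\<dots> = \<bar>C\<bar> * K * 16 * (x * (1 - x)) * (logit_weight x * (x * (1 - x)))"
      by (simp add: power2_eq_square)
    finally show "\<bar>transformed_hermite \<alpha> n x * sqrt (logit_weight x)\<bar> \<le> (\<bar>C\<bar> * K * 16) * (x * (1 - x))"
      unfolding w by simp
  qed (simp_all add: logit_weight_def)
qed

section \<open>Independence of the stochastic integrals\<close>

theorem theorem1:
  fixes M :: "'a measure" and W :: "real \<Rightarrow> 'a \<Rightarrow> real" and c \<alpha> :: real
  assumes "\<alpha> > 0"
    and "wiener_process M W c"
  shows "prob_space.indep_vars M (\<lambda>_. borel)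
           (\<lambda>n::nat. wiener_integral M W 0 1
              (\<lambda>s. transformed_hermite \<alpha> n s * sqrt (logit_weight s))) UNIV"
proof -
  interpret wiener_process M W c by fact
  let ?f = "\<lambda>n s. transformed_hermite \<alpha> n s * sqrt (logit_weight s)"
  show ?thesis
  proof (rule indep_vars_wiener_integrals_of_orthogonal[of 0 1 UNIV ?f])
    show "has_wiener_integral M W 0 1 (?f n) (wiener_integral M W 0 1 (?f n))" for n
      by (rule wiener_integral_continuous) (simp_all add: continuous_weighted_hermite \<open>\<alpha> > 0\<close>)
    show "(LINT x|lebesgue_on {0<..<1}. ?f n x * ?f m x) = 0" if "n \<noteq> m" for n m
      by (rule weighted_hermite_orthogonal[OF \<open>\<alpha> > 0\<close> that])
  qed simp_all
qed

end
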